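(* The decision problem VSC is $\exists\mathbb{R}$-hard; consequently VSC is $\exists\mathbb{R}$-complete.
   Context: Polynomials are given as explicit sums of monomials with integer coefficients written in binary; rational numbers are given as fractions of integers. The complexity class $\exists\mathbb{R}$ consists of all decision problems that are polynomial-time many-one reducible to the existential theory of the reals, i.e. the set of true sentences $\exists x_1\dots\exists x_n\,\Phi(x_1,\dots,x_n)$ where $\Phi$ is a quantifier-free Boolean combination of polynomial equations and inequalities with integer coefficients. A problem is $\exists\mathbb{R}$-hard if the existential theory of the reals (equivalently, the problem FEAS: given $r\in\mathbb{Z}[y_1,\dots,y_m]$, does $r$ have a real zero?) polynomial-time many-one reduces to it, and $\exists\mathbb{R}$-complete if it is $\exists\mathbb{R}$-hard and in $\exists\mathbb{R}$. VSC (Valley-Separated Clusters): Instance: a polynomial $f\in\mathbb{Z}[x_1,\dots,x_d]$ and a rational threshold $\theta>0$. Question: do there exist $p,q\in\mathbb{R}^d$ with $f(p)\ge\theta$, $f(q)\ge\theta$ and $f\big(\tfrac{p+q}{2}\big)<\theta$? *)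

theory Defs
  imports Complex_Main "HOL-Computational_Algebra.Polynomial"
begin

section \<open>Deterministic multi-tape Turing machines\<close>

text \<open>
  Tapes are two-way infinite with tape alphabet \<^typ>\<open>char option\<close>, where \<^term>\<open>None\<close> is the
  blank.  States are natural numbers: a machine starts in state \<open>0\<close>, the states below
  \<open>num_states\<close> are the running states, and \<open>num_states\<close> itself is the halting state.
\<close>

datatype dir = MoveLeft | Stay | MoveRight

record turing_machine =
  num_tapes :: nat
  num_states :: nat
  trans :: "nat \<Rightarrow> char option list \<Rightarrow> nat \<times> (char option \<times> dir) list"

definition wf_tm :: "turing_machine \<Rightarrow> bool" where
  "wf_tm M \<longleftrightarrow> num_tapes M \<ge> 2 \<and>
     (\<forall>q < num_states M. \<forall>s. length s = num_tapes M \<longrightarrow>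
        fst (trans M q s) \<le> num_states M \<and> length (snd (trans M q s)) = num_tapes M)"

text \<open>A tape is its cell contents together with the head position.\<close>

type_synonym tape = "(int \<Rightarrow> char option) \<times> int"
type_synonym config = "nat \<times> tape list"

fun move :: "dir \<Rightarrow> int \<Rightarrow> int" where
  "move MoveLeft h = h - 1"
| "move Stay h = h"
| "move MoveRight h = h + 1"

fun act :: "char option \<times> dir \<Rightarrow> tape \<Rightarrow> tape" where
  "act (a, m) (t, h) = (t(h := a), move m h)"

definition step :: "turing_machine \<Rightarrow> config \<Rightarrow> config" where
  "step M = (\<lambda>(q, ts).
     if q < num_states M then
       (let (q', as) = trans M q (map (\<lambda>(t, h). t h) ts) in (q', map2 act as ts))
     else (q, ts))"

definition word_cells :: "string \<Rightarrow> int \<Rightarrow> char option" where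
  "word_cells w = (\<lambda>i. if 0 \<le> i \<and> i < int (length w) then Some (w ! nat i) else None)"

text \<open>Input is on tape \<open>0\<close>; output is the complete contents of tape \<open>1\<close> on halting.\<close>

definition init_config :: "turing_machine \<Rightarrow> string \<Rightarrow> config" where
  "init_config M w = (0, (word_cells w, 0) # replicate (num_tapes M - 1) (\<lambda>_. None, 0))"

definition outputs_within :: "turing_machine \<Rightarrow> string \<Rightarrow> string \<Rightarrow> nat \<Rightarrow> bool" where
  "outputs_within M w v t \<longleftrightarrow>
     (\<exists>s \<le> t. case (step M ^^ s) (init_config M w) of
        (q, ts) \<Rightarrow> q = num_states M \<and> fst (ts ! 1) = word_cells v)"


section \<open>Decision problems and polynomial-time many-one reductions\<close>

text \<open>
  A decision problem is a set of instances with an injective encoding as strings over a finite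
  alphabet and a question, which is only relevant on instances.
\<close>

record 'a problem =
  instances :: "'a set"
  encode :: "'a \<Rightarrow> string"
  question :: "'a \<Rightarrow> bool"

definition wf_problem :: "'a problem \<Rightarrow> bool" where
  "wf_problem A \<longleftrightarrow> inj_on (encode A) (instances A)"

definition poly_time_computable :: "'a problem \<Rightarrow> 'b problem \<Rightarrow> ('a \<Rightarrow> 'b) \<Rightarrow> bool" where
  "poly_time_computable A B g \<longleftrightarrow>
     (\<exists>M (p :: nat poly). wf_tm M \<and>
        (\<forall>x \<in> instances A.
           outputs_within M (encode A x) (encode B (g x)) (poly p (length (encode A x)))))"

definition poly_time_reducible :: "'a problem \<Rightarrow> 'b problem \<Rightarrow> bool" where
  "poly_time_reducible A B \<longleftrightarrow>
     (\<exists>g. poly_time_computable A B g \<and>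
        (\<forall>x \<in> instances A. g x \<in> instances B \<and> (question A x \<longleftrightarrow> question B (g x))))"


section \<open>Polynomials as explicit sums of monomials\<close>

text \<open>
  The monomial \<open>c * x_1^e_1 * ... * x_n^e_n\<close> is \<open>(c, [e_1, ..., e_n])\<close>; a list of monomials stands
  for their sum, in which a monomial may be repeated.
\<close>

type_synonym monomial = "int \<times> nat list"
type_synonym mpolynomial = "monomial list"

definition in_vars :: "nat \<Rightarrow> mpolynomial \<Rightarrow> bool" where
  "in_vars n f \<longleftrightarrow> (\<forall>(c, es) \<in> set f. length es = n)"

fun eval_monomial :: "monomial \<Rightarrow> real list \<Rightarrow> real" where
  "eval_monomial (c, es) x = of_int c * (\<Prod>i < length es. x ! i ^ (es ! i))"

definition eval :: "mpolynomial \<Rightarrow> real list \<Rightarrow> real" where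
  "eval f x = (\<Sum>m \<leftarrow> f. eval_monomial m x)"

text \<open>
  Integers are written in binary, most significant digit first.  A monomial lists one block per
  variable, \<open>x\<close> followed by its exponent in tally marks, e.g. \<open>-101x11xx1;\<close> for
  \<open>-5 * x_1^2 * x_2^0 * x_3^1\<close>.  So only coefficients are written succinctly: exponents and the
  number of variables are unary, as in a monomial written out as a product of variables.
\<close>

definition digit :: "nat \<Rightarrow> char" where
  "digit b = (if b = 0 then CHR ''0'' else CHR ''1'')"

fun binary :: "nat \<Rightarrow> string" where
  "binary n = (if n < 2 then [digit n] else binary (n div 2) @ [digit (n mod 2)])"

declare binary.simps [simp del]

definition enc_int :: "int \<Rightarrow> string" where
  "enc_int z = (if z < 0 then ''-'' else []) @ binary (nat \<bar>z\<bar>)"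

fun enc_monomial :: "monomial \<Rightarrow> string" where
  "enc_monomial (c, es) = enc_int c @ concat (map (\<lambda>e. ''x'' @ replicate e (CHR ''1'')) es)"

definition enc_poly :: "mpolynomial \<Rightarrow> string" where
  "enc_poly f = concat (map (\<lambda>m. enc_monomial m @ '';'') f)"

definition enc_rat :: "rat \<Rightarrow> string" where
  "enc_rat r = (case quotient_of r of (a, b) \<Rightarrow> enc_int a @ ''/'' @ enc_int b)"

definition enc_dim :: "nat \<Rightarrow> string" where
  "enc_dim n = replicate n (CHR ''x'') @ ''#''"


section \<open>The existential theory of the reals\<close>

text \<open>The atoms are \<open>f = 0\<close>, \<open>f < 0\<close> and \<open>f \<le> 0\<close>.\<close>

datatype qf_formula =
    Zero mpolynomial
  | Negative mpolynomial
  | Nonpositive mpolynomial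
  | Neg qf_formula
  | Conj qf_formula qf_formula
  | Disj qf_formula qf_formula

fun formula_in_vars :: "nat \<Rightarrow> qf_formula \<Rightarrow> bool" where
  "formula_in_vars n (Zero f) \<longleftrightarrow> in_vars n f"
| "formula_in_vars n (Negative f) \<longleftrightarrow> in_vars n f"
| "formula_in_vars n (Nonpositive f) \<longleftrightarrow> in_vars n f"
| "formula_in_vars n (Neg \<phi>) \<longleftrightarrow> formula_in_vars n \<phi>"
| "formula_in_vars n (Conj \<phi> \<psi>) \<longleftrightarrow> formula_in_vars n \<phi> \<and> formula_in_vars n \<psi>"
| "formula_in_vars n (Disj \<phi> \<psi>) \<longleftrightarrow> formula_in_vars n \<phi> \<and> formula_in_vars n \<psi>"

fun holds :: "qf_formula \<Rightarrow> real list \<Rightarrow> bool" where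
  "holds (Zero f) x \<longleftrightarrow> eval f x = 0"
| "holds (Negative f) x \<longleftrightarrow> eval f x < 0"
| "holds (Nonpositive f) x \<longleftrightarrow> eval f x \<le> 0"
| "holds (Neg \<phi>) x \<longleftrightarrow> \<not> holds \<phi> x"
| "holds (Conj \<phi> \<psi>) x \<longleftrightarrow> holds \<phi> x \<and> holds \<psi> x"
| "holds (Disj \<phi> \<psi>) x \<longleftrightarrow> holds \<phi> x \<or> holds \<psi> x"

text \<open>Formulas are encoded in prefix notation; \<open>[\<close> stands for the atom \<open>\<le> 0\<close>.\<close>

fun enc_formula :: "qf_formula \<Rightarrow> string" where
  "enc_formula (Zero f) = ''='' @ enc_poly f @ ''.''"
| "enc_formula (Negative f) = ''<'' @ enc_poly f @ ''.''"
| "enc_formula (Nonpositive f) = ''['' @ enc_poly f @ ''.''"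
| "enc_formula (Neg \<phi>) = ''~'' @ enc_formula \<phi>"
| "enc_formula (Conj \<phi> \<psi>) = ''&'' @ enc_formula \<phi> @ enc_formula \<psi>"
| "enc_formula (Disj \<phi> \<psi>) = ''|'' @ enc_formula \<phi> @ enc_formula \<psi>"

text \<open>The instance \<open>(n, \<phi>)\<close> is the sentence that quantifies \<open>x_1, ..., x_n\<close> existentially in \<open>\<phi>\<close>.\<close>

definition ETR :: "(nat \<times> qf_formula) problem" where
  "ETR = \<lparr> instances = {(n, \<phi>). formula_in_vars n \<phi>},
           encode = (\<lambda>(n, \<phi>). enc_dim n @ enc_formula \<phi>),
           question = (\<lambda>(n, \<phi>). \<exists>x :: real list. length x = n \<and> holds \<phi> x) \<rparr>"

definition ER :: "'a problem set" where
  "ER = {A. wf_problem A \<and> poly_time_reducible A ETR}"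

definition ER_hard :: "'a problem \<Rightarrow> bool" where
  "ER_hard A \<longleftrightarrow> wf_problem A \<and> poly_time_reducible ETR A"

definition ER_complete :: "'a problem \<Rightarrow> bool" where
  "ER_complete A \<longleftrightarrow> ER_hard A \<and> A \<in> ER"


section \<open>Valley-separated clusters\<close>

definition midpoint_list :: "real list \<Rightarrow> real list \<Rightarrow> real list" where
  "midpoint_list p q = map2 (\<lambda>a b. (a + b) / 2) p q"

definition VSC :: "(nat \<times> mpolynomial \<times> rat) problem" where
  "VSC = \<lparr> instances = {(d, f, \<theta>). in_vars d f \<and> \<theta> > 0},
           encode = (\<lambda>(d, f, \<theta>). enc_dim d @ enc_poly f @ ''#'' @ enc_rat \<theta>),
           question = (\<lambda>(d, f, \<theta>). \<exists>p q :: real list. length p = d \<and> length q = d \<and>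
              eval f p \<ge> of_rat \<theta> \<and> eval f q \<ge> of_rat \<theta> \<and>
              eval f (midpoint_list p q) < of_rat \<theta>) \<rparr>"


section \<open>The encodings are injective\<close>

lemma append_sep_eq_iff:
  "c \<notin> set a \<Longrightarrow> c \<notin> set b \<Longrightarrow> a @ c # u = b @ c # v \<longleftrightarrow> a = b \<and> u = v"
proof (induction a arbitrary: b)
  case Nil
  then show ?case by (cases b) auto
next
  case (Cons d a)
  then show ?case by (cases b) auto
qed

lemma set_binary: "set (binary n) \<subseteq> {CHR ''0'', CHR ''1''}"
  by (induction n rule: binary.induct) (subst binary.simps, auto simp: digit_def)

lemma binary_ne: "binary n \<noteq> []"
  by (subst binary.simps) auto

lemma binary_inj: "binary m = binary n \<Longrightarrow> m = n"
proof (induction m arbitrary: n rule: less_induct)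
  case (less m)
  have len: "k < 2 \<longleftrightarrow> length (binary k) = 1" for k
    using binary_ne[of "k div 2"] by (subst binary.simps) (auto simp: neq_Nil_conv)
  have iff: "m < 2 \<longleftrightarrow> n < 2"
    using len less.prems by simp
  have dig: "digit a = digit b \<longleftrightarrow> a = b" if "a < 2" "b < 2" for a b
    using that by (auto simp: digit_def)
  show ?case
  proof (cases "m < 2")
    case True
    then show ?thesis
      using less.prems iff dig by (simp add: binary.simps[of m] binary.simps[of n])
  next
    case False
    then have "binary (m div 2) = binary (n div 2)" "digit (m mod 2) = digit (n mod 2)"
      using less.prems iff by (simp_all add: binary.simps[of m] binary.simps[of n])
    then have "m div 2 = n div 2" "m mod 2 = n mod 2"
      using less.IH[of "m div 2" "n div 2"] False dig[of "m mod 2" "n mod 2"] by auto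
    then show ?thesis
      by (metis div_mult_mod_eq)
  qed
qed

lemma set_enc_int: "set (enc_int z) \<subseteq> {CHR ''-'', CHR ''0'', CHR ''1''}"
  using set_binary by (auto simp: enc_int_def)

lemma enc_int_inj: "enc_int y = enc_int z \<Longrightarrow> y = z"
proof -
  have ne: "binary n \<noteq> CHR ''-'' # w" for n w
    using set_binary[of n] by auto
  assume "enc_int y = enc_int z"
  then show ?thesis
    using ne by (auto simp: enc_int_def split: if_splits dest!: binary_inj) (metis ne)+
qed

lemma tally_inj:
  "concat (map (\<lambda>e. ''x'' @ replicate e (CHR ''1'')) es) =
   concat (map (\<lambda>e. ''x'' @ replicate e (CHR ''1'')) fs) \<Longrightarrow> es = fs"
proof (induction es arbitrary: fs)
  case Nil
  then show ?case by (cases fs) auto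
next
  let ?c = "\<lambda>es. concat (map (\<lambda>e. ''x'' @ replicate e (CHR ''1'')) es)"
  case (Cons e es)
  then obtain f fs' where fs: "fs = f # fs'" by (cases fs) auto
  have tw: "takeWhile (\<lambda>a. a = CHR ''1'') (replicate n (CHR ''1'') @ ?c gs) = replicate n (CHR ''1'')"
    for n gs by (subst takeWhile_append2) (cases gs; auto)+
  have eq: "replicate e (CHR ''1'') @ ?c es = replicate f (CHR ''1'') @ ?c fs'"
    using Cons.prems fs by simp
  then have "replicate e (CHR ''1'') = replicate f (CHR ''1'')"
    using tw by metis
  then have "e = f" by (metis length_replicate)
  then show ?case using eq Cons.IH fs by simp
qed

lemma enc_monomial_inj: "enc_monomial m = enc_monomial n \<Longrightarrow> m = n"
proof -
  assume eq: "enc_monomial m = enc_monomial n"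
  obtain c es where m: "m = (c, es)" by (cases m)
  obtain d fs where n: "n = (d, fs)" by (cases n)
  let ?c = "\<lambda>es. concat (map (\<lambda>e. ''x'' @ replicate e (CHR ''1'')) es)"
  have tw: "takeWhile (\<lambda>a. a \<noteq> CHR ''x'') (enc_int c @ ?c es) = enc_int c" for c es
  proof -
    have "a \<noteq> CHR ''x''" if "a \<in> set (enc_int c)" for a
      using set_enc_int[of c] that by auto
    then have "takeWhile (\<lambda>a. a \<noteq> CHR ''x'') (enc_int c @ ?c es) =
               enc_int c @ takeWhile (\<lambda>a. a \<noteq> CHR ''x'') (?c es)"
      by (rule takeWhile_append2)
    also have "takeWhile (\<lambda>a. a \<noteq> CHR ''x'') (?c es) = []"
      by (cases es) auto
    finally show ?thesis by simp
  qed
  have "enc_int c = enc_int d"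
    using eq tw m n by (metis enc_monomial.simps)
  then show ?thesis
    using eq m n enc_int_inj tally_inj by auto
qed

lemma set_enc_monomial:
  "set (enc_monomial m) \<subseteq> {CHR ''-'', CHR ''0'', CHR ''1'', CHR ''x''}"
  using set_enc_int by (cases m) (auto split: if_splits)

lemma set_enc_poly:
  "set (enc_poly f) \<subseteq> {CHR ''-'', CHR ''0'', CHR ''1'', CHR ''x'', CHR '';''}"
proof (induction f)
  case (Cons m f)
  have "set (enc_poly (m # f)) = set (enc_monomial m) \<union> {CHR '';''} \<union> set (enc_poly f)"
    by (simp add: enc_poly_def)
  then show ?case using Cons.IH set_enc_monomial[of m] by blast
qed (simp add: enc_poly_def)

lemma enc_poly_inj: "enc_poly f = enc_poly g \<Longrightarrow> f = g"
proof (induction f arbitrary: g)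
  case Nil
  then show ?case by (cases g) (auto simp: enc_poly_def)
next
  case (Cons m f)
  then obtain n g' where g: "g = n # g'" by (cases g) (auto simp: enc_poly_def)
  have sep: "CHR '';'' \<notin> set (enc_monomial k)" for k
    using set_enc_monomial[of k] by auto
  have "enc_monomial m @ CHR '';'' # enc_poly f = enc_monomial n @ CHR '';'' # enc_poly g'"
    using Cons.prems by (simp add: g enc_poly_def)
  then have "enc_monomial m = enc_monomial n" "enc_poly f = enc_poly g'"
    by (simp_all add: append_sep_eq_iff[OF sep sep])
  then show ?case using Cons.IH enc_monomial_inj g by blast
qed

lemma enc_poly_dot_inj:
  "enc_poly f @ CHR ''.'' # u = enc_poly g @ CHR ''.'' # v \<longleftrightarrow> f = g \<and> u = v"
proof -
  have sep: "CHR ''.'' \<notin> set (enc_poly k)" for k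
    using set_enc_poly[of k] by auto
  show ?thesis
    unfolding append_sep_eq_iff[OF sep sep] using enc_poly_inj by blast
qed

lemma enc_formula_prefix_free:
  "enc_formula \<phi> @ u = enc_formula \<psi> @ v \<longleftrightarrow> \<phi> = \<psi> \<and> u = v"
proof (induction \<phi> arbitrary: \<psi> u v)
  case (Zero f)
  show ?case by (cases \<psi>) (simp_all add: enc_poly_dot_inj)
next
  case (Negative f)
  show ?case by (cases \<psi>) (simp_all add: enc_poly_dot_inj)
next
  case (Nonpositive f)
  show ?case by (cases \<psi>) (simp_all add: enc_poly_dot_inj)
next
  case (Neg \<phi>)
  show ?case by (cases \<psi>) (simp_all add: Neg.IH)
next
  case (Conj \<phi>1 \<phi>2)
  show ?case by (cases \<psi>) (simp_all add: Conj.IH)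
next
  case (Disj \<phi>1 \<phi>2)
  show ?case by (cases \<psi>) (simp_all add: Disj.IH)
qed

lemma enc_dim_inj: "enc_dim m @ u = enc_dim n @ v \<longleftrightarrow> m = n \<and> u = v"
  by (simp add: enc_dim_def append_sep_eq_iff)

lemma enc_rat_inj: "enc_rat r = enc_rat s \<Longrightarrow> r = s"
proof -
  obtain a b where r: "quotient_of r = (a, b)" by (cases "quotient_of r")
  obtain c d where s: "quotient_of s = (c, d)" by (cases "quotient_of s")
  have *: "CHR ''/'' \<notin> set (enc_int z)" for z
    using set_enc_int[of z] by auto
  assume "enc_rat r = enc_rat s"
  then have "enc_int a @ CHR ''/'' # enc_int b = enc_int c @ CHR ''/'' # enc_int d"
    by (simp add: enc_rat_def r s)
  then have "a = c \<and> b = d"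
    unfolding append_sep_eq_iff[OF * *] using enc_int_inj by blast
  then show "r = s"
    using r s quotient_of_inject by simp
qed

lemma wf_problem_ETR: "wf_problem ETR"
proof -
  have "\<phi> = \<psi>" if "enc_formula \<phi> = enc_formula \<psi>" for \<phi> \<psi>
    using enc_formula_prefix_free[of \<phi> "[]" \<psi> "[]"] that by simp
  then show ?thesis
    by (auto simp: wf_problem_def ETR_def inj_on_def enc_dim_inj)
qed

lemma wf_problem_VSC: "wf_problem VSC"
proof -
  have *: "CHR ''#'' \<notin> set (enc_poly k)" for k
    using set_enc_poly[of k] by auto
  have "f = g \<and> r = s"
    if "enc_poly f @ CHR ''#'' # enc_rat r = enc_poly g @ CHR ''#'' # enc_rat s" for f g r s
  proof -
    have "enc_poly f = enc_poly g \<and> enc_rat r = enc_rat s"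
      using that append_sep_eq_iff[OF * *] by blast
    then show ?thesis using enc_poly_inj enc_rat_inj by blast
  qed
  then show ?thesis
    by (auto simp: wf_problem_def VSC_def inj_on_def enc_dim_inj)
qed

end

theory Submission
  imports Defs "HOL-Library.Sublist"
begin

text \<open>
  Both reductions are computed by machines that sweep over their work tape again and again, rewriting
  each cell in place and printing; a finite control that makes polynomially many sweeps is a
  polynomial-time Turing machine with a work tape and an output tape.

  Membership: \<open>f(p) \<ge> \<theta>\<close>, \<open>f(q) \<ge> \<theta>\<close>, \<open>f(m) < \<theta>\<close> and \<open>2m = p + q\<close> is an existential sentence once the
  fraction \<open>\<theta> = a/b\<close> is named by a variable \<open>t\<close> with \<open>b t = a\<close>.  Keeping \<open>p_k, q_k, m_k\<close> adjacent makes
  the copies of \<open>f\<close> a letter-by-letter rewriting.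

  Hardness: every cell \<open>i\<close> of the encoded sentence gets ten real variables that describe the evaluation
  of the part of the sentence from \<open>i\<close> on, read from right to left.  The stack of truth values of this
  evaluation is a single real number, pushing \<open>t\<close> onto \<open>s\<close> giving \<open>(2t + s)/3\<close>; the value \<open>s \<in> [0, 1]\<close>
  determines its digits as in the Cantor set.  All steps are then polynomial equations between the
  variables of adjacent cells (and one variable of the sentence), with a bounded number of monomials,
  so that their squares can be expanded in the finite control.  With one further equation \<open>z\<^sup>2 = 1\<close>,
  the polynomial \<open>1 - (sum of the squares)\<close> reaches \<open>1\<close> exactly at the solutions, and the midpoint of
  two solutions that differ in the sign of \<open>z\<close> is no solution.
\<close>

section \<open>Sweep machines\<close>

text \<open>Both reductions must be carried out by explicit Turing machines, and this shapes them.
  An encoded monomial has one block per variable, so with a fixed number of variables per tape cell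
  one sweep prints the exponents of one monomial. Hence hardness works with the characters of the
  sentence, each contributing boundedly many constraints with constant coefficients. Squaring the
  atoms themselves would need products of all pairs of monomials and of binary coefficients;
  instead, the real variables recompute each polynomial digit by digit. Base 3 keeps the two images
  of [0, 1] under a push, [0, 1/3] and [2/3, 1], disjoint; in base 2, pushing 0 onto 1 and 1 onto 0
  would both give 1/2. Truth values must be determined exactly, not just implied, because of
  negation. The variable z is there because a true sentence may have a single solution or a convex
  set of them, which leaves no valley.\<close>

fun pass :: "('s \<Rightarrow> char \<Rightarrow> 's \<times> char \<times> string) \<Rightarrow> 's \<Rightarrow> string \<Rightarrow> 's \<times> string \<times> string" where
  "pass \<delta> q [] = (q, [], [])"
| "pass \<delta> q (c # w) =
     (case \<delta> q c of (q1, c1, u1) \<Rightarrow> case pass \<delta> q1 w of (q2, w2, u2) \<Rightarrow> (q2, c1 # w2, u1 @ u2))"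

lemma pass_append:
  "pass \<delta> q (v @ w) =
     (case pass \<delta> q v of (q1, v1, u1) \<Rightarrow> case pass \<delta> q1 w of (q2, w2, u2) \<Rightarrow> (q2, v1 @ w2, u1 @ u2))"
  by (induction v arbitrary: q) (auto split: prod.splits)

lemma pass_append_eq:
  "pass \<delta> q v = (q1, v1, u1) \<Longrightarrow> pass \<delta> q1 w = (q2, w2, u2) \<Longrightarrow>
   pass \<delta> q (v @ w) = (q2, v1 @ w2, u1 @ u2)"
  by (simp add: pass_append)

lemma length_pass: "pass \<delta> q w = (q', w', u) \<Longrightarrow> length w' = length w"
  by (induction w arbitrary: q q' w' u) (auto split: prod.splits)

text \<open>\<open>fin\<close> is consulted once per sweep, at the blank behind the word. Since a
  pass keeps the length of the word, the number \<open>m\<close> of sweeps measures running time up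
  to a linear factor.\<close>

inductive sweeps ::
  "('s \<Rightarrow> char \<Rightarrow> 's \<times> char \<times> string) \<Rightarrow> ('s \<Rightarrow> string \<times> 's option) \<Rightarrow> nat \<Rightarrow> 's \<Rightarrow> string \<Rightarrow> string \<Rightarrow> bool"
  for \<delta> fin where
  stop: "pass \<delta> q w = (q', w', u) \<Longrightarrow> fin q' = (e, None) \<Longrightarrow> sweeps \<delta> fin 1 q w (u @ e)"
| again: "pass \<delta> q w = (q', w', u) \<Longrightarrow> fin q' = (e, Some q'') \<Longrightarrow> sweeps \<delta> fin m q'' w' v
     \<Longrightarrow> sweeps \<delta> fin (Suc m) q w (u @ e @ v)"

lemma sweeps_againI:
  "pass \<delta> q w = (q', w', u) \<Longrightarrow> fin q' = (e, Some q'') \<Longrightarrow> sweeps \<delta> fin m q'' w' v \<Longrightarrow>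
   x = u @ e @ v \<Longrightarrow> sweeps \<delta> fin (Suc m) q w x"
  using again by metis

section \<open>Simulation of sweeps by steps on a work tape and an output tape\<close>

datatype 's control = Fwd 's | Back 's | Stop

text \<open>The first component of a state holds the characters that are still to be printed.\<close>

fun tm_rule :: "('s \<Rightarrow> char \<Rightarrow> 's \<times> char \<times> string) \<Rightarrow> ('s \<Rightarrow> string \<times> 's option) \<Rightarrow>
    string \<times> 's control \<Rightarrow> char option \<Rightarrow>
    (string \<times> 's control) \<times> (char option \<times> dir) \<times> (char option \<times> dir)" where
  "tm_rule \<delta> fin (a # u, k) r = ((u, k), (r, Stay), (Some a, MoveRight))"
| "tm_rule \<delta> fin ([], Fwd q) (Some c) =
     (case \<delta> q c of (q', c', u) \<Rightarrow> ((u, Fwd q'), (Some c', MoveRight), (None, Stay)))"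
| "tm_rule \<delta> fin ([], Fwd q) None =
     (case fin q of (u, Some q') \<Rightarrow> ((u, Back q'), (None, MoveLeft), (None, Stay))
                  | (u, None) \<Rightarrow> ((u, Stop), (None, Stay), (None, Stay)))"
| "tm_rule \<delta> fin ([], Back q) (Some c) = (([], Back q), (Some c, MoveLeft), (None, Stay))"
| "tm_rule \<delta> fin ([], Back q) None = (([], Fwd q), (None, MoveRight), (None, Stay))"
| "tm_rule \<delta> fin ([], Stop) r = (([], Stop), (r, Stay), (None, Stay))"

definition sweep_step where
  "sweep_step \<delta> fin = (\<lambda>(\<sigma>, T, U). case tm_rule \<delta> fin \<sigma> (fst T (snd T)) of
     (\<sigma>', a, b) \<Rightarrow> (\<sigma>', act a T, act b U))"

definition printed :: "string \<Rightarrow> tape" where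
  "printed u = (word_cells u, int (length u))"

definition tape_at :: "string \<Rightarrow> int \<Rightarrow> tape" where
  "tape_at w h = (word_cells w, h)"

lemma word_cells_snoc: "(word_cells u)(int (length u) := Some a) = word_cells (u @ [a])"
  by (auto simp: word_cells_def fun_eq_iff nth_append)

lemma word_cells_end: "word_cells u (int (length u)) = None"
  by (simp add: word_cells_def)

lemma word_cells_mid: "word_cells (p @ c # w) (int (length p)) = Some c"
  by (simp add: word_cells_def)

lemma word_cells_upd: "(word_cells (p @ c # w))(int (length p) := Some c') = word_cells (p @ c' # w)"
  by (auto simp: word_cells_def fun_eq_iff nth_append nth_Cons split: nat.split)

lemma printed_stay [simp]: "act (None, Stay) (printed u) = printed u"
  using word_cells_end[of u] by (auto simp: printed_def fun_eq_iff)

lemma printed_right [simp]: "act (Some a, MoveRight) (printed u) = printed (u @ [a])"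
  by (simp add: printed_def word_cells_snoc)

lemma act_same: "act (fst T (snd T), m) T = (fst T, move m (snd T))"
  by (cases T) simp

lemma run_print:
  "(sweep_step \<delta> fin ^^ length v) ((v, k), T, printed u) = (([], k), T, printed (u @ v))"
proof (induction v arbitrary: u)
  case (Cons a v)
  have "(sweep_step \<delta> fin) ((a # v, k), T, printed u) = ((v, k), T, printed (u @ [a]))"
    by (simp add: sweep_step_def act_same)
  then show ?case using Cons.IH[of "u @ [a]"] by (simp add: funpow_Suc_right del: funpow.simps)
qed simp

lemma funpow_trans:
  "(f ^^ a) x = y \<Longrightarrow> (f ^^ b) y = z \<Longrightarrow> (f ^^ (a + b)) x = z"
  by (simp add: add.commute[of a b] funpow_add)

lemma run_pass:
  "pass \<delta> q w = (q', w', v) \<Longrightarrow>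
   (sweep_step \<delta> fin ^^ (length w + length v)) (([], Fwd q), tape_at (p @ w) (int (length p)), printed u)
     = (([], Fwd q'), tape_at (p @ w') (int (length (p @ w))), printed (u @ v))"
proof (induction w arbitrary: p q u q' w' v)
  case (Cons c w)
  obtain q1 c1 u1 where d: "\<delta> q c = (q1, c1, u1)" by (cases "\<delta> q c")
  obtain q2 w2 u2 where r: "pass \<delta> q1 w = (q2, w2, u2)" by (cases "pass \<delta> q1 w")
  have e: "q' = q2" "w' = c1 # w2" "v = u1 @ u2" using Cons.prems d r by auto
  have "(sweep_step \<delta> fin ^^ 1) (([], Fwd q), tape_at (p @ c # w) (int (length p)), printed u)
     = ((u1, Fwd q1), tape_at ((p @ [c1]) @ w) (int (length (p @ [c1]))), printed u)"
    by (simp add: sweep_step_def tape_at_def word_cells_mid word_cells_upd d)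
  from funpow_trans[OF funpow_trans[OF this run_print] Cons.IH[OF r]]
  show ?case by (simp add: e algebra_simps)
qed simp

text \<open>The blank at position -1 ends the rewinding, and one more step returns to 0. The premise
  on \<open>U\<close> is met by printed tapes, whose head rests on a blank.\<close>

lemma run_back:
  "k \<le> length w \<Longrightarrow>
   (sweep_step \<delta> fin ^^ Suc k) (([], Back q), tape_at w (int k - 1), U)
     = (([], Fwd q), tape_at w 0, act (None, Stay) U)"
  if "act (None, Stay) U = U"
proof (induction k)
  case 0
  have "(sweep_step \<delta> fin ^^ 1) (([], Back q), tape_at w (- 1), U)
     = (([], Fwd q), tape_at w 0, act (None, Stay) U)"
    by (simp add: sweep_step_def tape_at_def word_cells_def fun_eq_iff)
  then show ?case by simp
next
  case (Suc k)
  have c: "word_cells w (int k) = Some (w ! k)" using Suc.prems by (simp add: word_cells_def)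
  have "(sweep_step \<delta> fin ^^ 1) (([], Back q), tape_at w (int k), U)
     = (([], Back q), tape_at w (int k - 1), U)"
    using that c by (auto simp add: sweep_step_def tape_at_def fun_eq_iff)
  from funpow_trans[OF this Suc.IH] Suc.prems
  show ?case by simp
qed


locale sweep_machine =
  fixes \<delta> :: "'s \<Rightarrow> char \<Rightarrow> 's \<times> char \<times> string" and fin :: "'s \<Rightarrow> string \<times> 's option"
    and Q :: "'s set" and q0 :: 's
  assumes finite_Q: "finite Q" and start: "q0 \<in> Q"
    and delta_Q: "q \<in> Q \<Longrightarrow> fst (\<delta> q c) \<in> Q"
    and fin_Q: "q \<in> Q \<Longrightarrow> fin q = (e, Some q') \<Longrightarrow> q' \<in> Q"
begin

text \<open>Everything a single move can load into the printing buffer: finitely many strings, as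
  \<open>char\<close> is finite, which keeps the buffer within a finite control.\<close>

definition outs :: "string set" where
  "outs = (\<Union>q\<in>Q. insert (fst (fin q)) (range (\<lambda>c. snd (snd (\<delta> q c)))))"

definition bound :: nat where
  "bound = Max (length ` outs)"

lemma finite_outs: "finite outs"
  unfolding outs_def using finite_Q by auto

lemma bound_outs: "u \<in> outs \<Longrightarrow> length u \<le> bound"
  unfolding bound_def using finite_outs by auto

lemma delta_outs: "q \<in> Q \<Longrightarrow> \<delta> q c = (q', c', u) \<Longrightarrow> u \<in> outs"
  unfolding outs_def by (force intro!: bexI[of _ q] image_eqI[of _ _ c])

lemma fin_outs: "q \<in> Q \<Longrightarrow> fin q = (u, r) \<Longrightarrow> u \<in> outs"
  unfolding outs_def by (force intro!: bexI[of _ q])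

lemma pass_Q:
  "q \<in> Q \<Longrightarrow> pass \<delta> q w = (q', w', u) \<Longrightarrow> q' \<in> Q \<and> length u \<le> bound * length w"
proof (induction w arbitrary: q q' w' u)
  case (Cons c w)
  obtain q1 c1 u1 where d: "\<delta> q c = (q1, c1, u1)" by (cases "\<delta> q c")
  obtain q2 w2 u2 where r: "pass \<delta> q1 w = (q2, w2, u2)" by (cases "pass \<delta> q1 w")
  have "q1 \<in> Q" using delta_Q[OF Cons.prems(1), of c] d by simp
  from Cons.IH[OF this r] bound_outs[OF delta_outs[OF Cons.prems(1) d]] Cons.prems d r
  show ?case by auto
qed simp

lemma run_sweep:
  assumes q: "q \<in> Q" and p: "pass \<delta> q w = (q', w', v)" and f: "fin q' = (e, r)"
  obtains s where "s + length w + 1 \<le> (bound + 2) * Suc (length w)"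
    and "(sweep_step \<delta> fin ^^ s) (([], Fwd q), tape_at w 0, printed u)
         = (case r of None \<Rightarrow> (([], Stop), tape_at w' (int (length w)), printed (u @ v @ e))
            | Some q'' \<Rightarrow> (([], Back q''), tape_at w' (int (length w) - 1), printed (u @ v @ e)))"
proof -
  have len: "length w' = length w" using length_pass[OF p] .
  have q': "q' \<in> Q" and lv: "length v \<le> bound * length w" using pass_Q[OF q p] by auto
  have le: "length e \<le> bound" using bound_outs[OF fin_outs[OF q' f]] .
  define k where "k = (case r of None \<Rightarrow> Stop | Some q'' \<Rightarrow> Back q'')"
  define h where "h = (case r of None \<Rightarrow> int (length w) | Some q'' \<Rightarrow> int (length w) - 1)"
  have none: "word_cells w' (int (length w)) = None" using len by (simp add: word_cells_def)
  have 1: "(sweep_step \<delta> fin ^^ (length w + length v)) (([], Fwd q), tape_at w 0, printed u)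
     = (([], Fwd q'), tape_at w' (int (length w)), printed (u @ v))"
    using run_pass[OF p, where p = "[]"] by simp
  have 2: "(sweep_step \<delta> fin ^^ 1) (([], Fwd q'), tape_at w' (int (length w)), printed (u @ v))
     = ((e, k), tape_at w' h, printed (u @ v))"
    using none by (auto simp: sweep_step_def tape_at_def f k_def h_def fun_eq_iff split: option.split)
  have 3: "(sweep_step \<delta> fin ^^ (length w + length v + 1 + length e))
      (([], Fwd q), tape_at w 0, printed u) = (([], k), tape_at w' h, printed (u @ v @ e))"
    using funpow_trans[OF funpow_trans[OF 1 2] run_print] by simp
  show thesis
  proof (rule that)
    \<comment> \<open>With n = length w: n reading steps, at most bound times n printing steps, one
      turn, at most bound further symbols from \<open>fin\<close>, and n + 1 steps reserved for the
      rewinding.\<close>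
    show "length w + length v + 1 + length e + length w + 1 \<le> (bound + 2) * Suc (length w)"
      using lv le by (simp add: algebra_simps)
  qed (use 3 in \<open>auto simp: k_def h_def split: option.split\<close>)
qed

lemma run_sweeps:
  "sweeps \<delta> fin m q w v \<Longrightarrow> q \<in> Q \<Longrightarrow>
   \<exists>s T. s \<le> m * ((bound + 2) * Suc (length w)) \<and>
    (sweep_step \<delta> fin ^^ s) (([], Fwd q), tape_at w 0, printed u) = (([], Stop), T, printed (u @ v))"
proof (induction arbitrary: u rule: sweeps.induct)
  case (stop q w q' w' v e)
  obtain s where "s + length w + 1 \<le> (bound + 2) * Suc (length w)"
    "(sweep_step \<delta> fin ^^ s) (([], Fwd q), tape_at w 0, printed u)
       = (([], Stop), tape_at w' (int (length w)), printed (u @ v @ e))"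
    using run_sweep[OF stop(3,1,2)] by auto
  then show ?case by (intro exI[of _ s]) auto
next
  case (again q w q' w' v e q'' m v')
  have len: "length w' = length w" using length_pass[OF again(1)] .
  obtain s where s: "s + length w + 1 \<le> (bound + 2) * Suc (length w)"
    "(sweep_step \<delta> fin ^^ s) (([], Fwd q), tape_at w 0, printed u)
       = (([], Back q''), tape_at w' (int (length w) - 1), printed (u @ v @ e))"
    using run_sweep[OF again(5,1,2)] by auto
  have rew: "(sweep_step \<delta> fin ^^ Suc (length w)) (([], Back q''), tape_at w' (int (length w) - 1), printed (u @ v @ e))
     = (([], Fwd q''), tape_at w' 0, printed (u @ v @ e))"
    using run_back[of "printed (u @ v @ e)" "length w" w'] len by (simp del: funpow.simps)
  have "q'' \<in> Q" using fin_Q[OF _ again(2)] pass_Q[OF again(5,1)] by auto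
  from again.IH[OF this, of "u @ v @ e"] obtain s' T where
    s': "s' \<le> m * ((bound + 2) * Suc (length w'))"
    "(sweep_step \<delta> fin ^^ s') (([], Fwd q''), tape_at w' 0, printed (u @ v @ e))
      = (([], Stop), T, printed ((u @ v @ e) @ v'))" by auto
  show ?case
    using funpow_trans[OF funpow_trans[OF s(2) rew] s'(2)] s(1) s'(1) len
    by (intro exI[of _ "s + Suc (length w) + s'"] exI[of _ T]) (auto simp: algebra_simps)
qed

section \<open>Finiteness of the control and the resulting Turing machine\<close>

definition states :: "(string \<times> 's control) set" where
  "states = {(u, k). (\<exists>v\<in>insert [] outs. suffix u v) \<and> k \<in> Fwd ` Q \<union> Back ` Q \<union> {Stop}}"

lemma finite_states: "finite states"
proof -
  have "states = (\<Union>u\<in>insert [] outs. set (suffixes u)) \<times> (Fwd ` Q \<union> Back ` Q \<union> {Stop})"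
    by (rule set_eqI) (simp only: states_def set_suffixes_eq UN_iff mem_Collect_eq mem_Times_iff case_prod_beta)
  then show ?thesis using finite_outs finite_Q by simp
qed

lemma Nil_states: "k \<in> Fwd ` Q \<union> Back ` Q \<union> {Stop} \<Longrightarrow> ([], k) \<in> states"
  by (auto simp: states_def)

lemma outs_states: "u \<in> outs \<Longrightarrow> k \<in> Fwd ` Q \<union> Back ` Q \<union> {Stop} \<Longrightarrow> (u, k) \<in> states"
  unfolding states_def by (simp only: mem_Collect_eq case_prod_conv) blast

lemma rule_states: "\<sigma> \<in> states \<Longrightarrow> fst (tm_rule \<delta> fin \<sigma> r) \<in> states"
proof -
  assume "\<sigma> \<in> states"
  then obtain u k where \<sigma>: "\<sigma> = (u, k)" and u: "\<exists>v\<in>insert [] outs. suffix u v"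
    and k: "k \<in> Fwd ` Q \<union> Back ` Q \<union> {Stop}"
    by (cases \<sigma>) (simp only: states_def mem_Collect_eq case_prod_conv)
  show ?thesis
  proof (cases u)
    case (Cons a u')
    then have "\<exists>v\<in>insert [] outs. suffix u' v" using u by (metis suffix_ConsD)
    then show ?thesis using k Cons \<sigma> by (simp only: states_def tm_rule.simps fst_conv mem_Collect_eq case_prod_conv)
  next
    case Nil
    from k consider q where "k = Fwd q" "q \<in> Q" | q where "k = Back q" "q \<in> Q" | "k = Stop" by auto
    then show ?thesis
    proof cases
      case (1 q)
      show ?thesis
      proof (cases r)
        case None
        show ?thesis
          using 1 Nil \<sigma> fin_Q[OF 1(2)] fin_outs[OF 1(2)]
          by (auto simp: None split: prod.split option.split intro!: outs_states)
      next
        case (Some c)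
        show ?thesis
          using 1 Nil \<sigma> delta_Q[OF 1(2), of c] delta_outs[OF 1(2), of c]
          by (auto simp: Some split: prod.split intro!: outs_states)
      qed
    next
      case (2 q)
      then show ?thesis using Nil \<sigma> by (cases r) (auto intro!: Nil_states)
    next
      case 3
      then show ?thesis using Nil \<sigma> by (auto intro!: Nil_states)
    qed
  qed
qed

theorem poly_time:
  assumes run: "\<And>x. x \<in> instances A \<Longrightarrow>
     \<exists>m \<le> poly r (length (encode A x)). sweeps \<delta> fin m q0 (encode A x) (encode B (g x))"
  shows "poly_time_computable A B g"
proof -
  define start where "start = (([], Fwd q0) :: string \<times> 's control)"
  define halt where "halt = (([], Stop) :: string \<times> 's control)"
  define N where "N = Suc (card (states - {start, halt}))"
  have sh: "start \<in> states" "halt \<in> states" "start \<noteq> halt"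
    using sweep_machine.start[OF sweep_machine_axioms] by (auto simp: start_def halt_def intro: Nil_states)
  obtain f where f: "bij_betw f (states - {start, halt}) {0..<card (states - {start, halt})}"
    using ex_bij_betw_finite_nat[of "states - {start, halt}"] finite_states by auto
  \<comment> \<open>The machine model dictates 0 for the start and \<open>num_states\<close> for
    halting; all other states are numbered in between.\<close>
  define code where "code \<sigma> = (if \<sigma> = start then 0 else if \<sigma> = halt then N else Suc (f \<sigma>))" for \<sigma>
  have f_less: "f \<sigma> < N - 1" if "\<sigma> \<in> states" "\<sigma> \<noteq> start" "\<sigma> \<noteq> halt" for \<sigma>
    using bij_betwE[OF f] that by (auto simp: N_def)
  have code_le: "code \<sigma> \<le> N" if "\<sigma> \<in> states" for \<sigma>
    using f_less[OF that] by (auto simp: code_def N_def)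
  have code_less: "code \<sigma> < N" if "\<sigma> \<in> states" "\<sigma> \<noteq> halt" for \<sigma>
    using f_less[OF that(1)] that(2) by (auto simp: code_def N_def)
  have inj: "inj_on code states"
  proof (rule inj_onI)
    fix \<sigma> \<tau> assume m: "\<sigma> \<in> states" "\<tau> \<in> states" "code \<sigma> = code \<tau>"
    show "\<sigma> = \<tau>"
      using m f_less[OF m(1)] f_less[OF m(2)] sh(3) inj_onD[OF bij_betw_imp_inj_on[OF f], of \<sigma> \<tau>]
      by (auto simp: code_def N_def split: if_splits)
  qed
  have surj: "\<exists>\<sigma>\<in>states. code \<sigma> = i" if "i < N" for i
  proof (cases i)
    case 0
    then show ?thesis using sh by (auto simp: code_def)
  next
    case (Suc j)
    then have "j \<in> f ` (states - {start, halt})"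
      using bij_betw_imp_surj_on[OF f] that by (auto simp: N_def)
    then show ?thesis using Suc by (auto simp: code_def)
  qed
  define tr where "tr i s = (case tm_rule \<delta> fin (inv_into states code i) (s ! 0) of
     (\<sigma>, a, b) \<Rightarrow> (code \<sigma>, [a, b]))" for i and s :: "char option list"
  define M where "M = \<lparr>num_tapes = 2, num_states = N, trans = tr\<rparr>"
  have wf: "wf_tm M"
  proof -
    have "code (fst (tm_rule \<delta> fin (inv_into states code i) c)) \<le> N" if "i < N" for i c
    proof -
      have "inv_into states code i \<in> states"
        using surj[OF that] by (metis imageI inv_into_into)
      from code_le[OF rule_states[OF this]] show ?thesis .
    qed
    then show ?thesis by (auto simp: wf_tm_def M_def tr_def split: prod.splits) (metis fst_conv)
  qed
  define conf where "conf = (\<lambda>(\<sigma>, T, U). (code \<sigma>, [T, U :: tape]))"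
  have step: "step M (conf (\<sigma>, T, printed u)) = conf (sweep_step \<delta> fin (\<sigma>, T, printed u))"
    if "\<sigma> \<in> states" for \<sigma> T u
  proof (cases "\<sigma> = halt")
    case True
    then have "sweep_step \<delta> fin (\<sigma>, T, printed u) = (\<sigma>, T, printed u)"
      by (cases T) (simp add: sweep_step_def halt_def)
    then show ?thesis using True sh by (simp add: step_def conf_def M_def code_def)
  next
    case False
    have less: "code \<sigma> < num_states M" using code_less[OF that False] by (simp add: M_def)
    obtain t h where T: "T = (t, h)" by (cases T)
    obtain \<sigma>' a b where r: "tm_rule \<delta> fin \<sigma> (t h) = (\<sigma>', a, b)" by (cases "tm_rule \<delta> fin \<sigma> (t h)")
    have "tr (code \<sigma>) [t h, c] = (code \<sigma>', [a, b])" for c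
      by (simp add: tr_def inv_into_f_f[OF inj that] r)
    then show ?thesis using less
      by (simp add: step_def conf_def sweep_step_def M_def T r printed_def del: act.simps)
  qed
  have inv: "\<exists>\<sigma>' T' u'. sweep_step \<delta> fin (\<sigma>, T, printed u) = (\<sigma>', T', printed u') \<and> \<sigma>' \<in> states"
    if "\<sigma> \<in> states" for \<sigma> T u
  proof -
    have "snd (snd (tm_rule \<delta> fin \<sigma> r)) \<in> insert (None, Stay) (range (\<lambda>a. (Some a, MoveRight)))" for r
      by (induction \<delta> fin \<sigma> r rule: tm_rule.induct) (auto split: prod.split option.split)
    then have "\<exists>u'. act (snd (snd (tm_rule \<delta> fin \<sigma> r))) (printed u) = printed u'" for r
      using printed_stay printed_right by (smt (verit) imageE insertE)
    from this[of "fst T (snd T)"] rule_states[OF that, of "fst T (snd T)"] show ?thesis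
      by (auto simp: sweep_step_def simp del: act.simps split: prod.split)
  qed
  have steps: "(step M ^^ s) (conf (\<sigma>, T, printed u)) = conf ((sweep_step \<delta> fin ^^ s) (\<sigma>, T, printed u))"
    if "\<sigma> \<in> states" for \<sigma> T u s
    using that
  proof (induction s arbitrary: \<sigma> T u)
    case (Suc s)
    obtain \<sigma>' T' u' where n: "sweep_step \<delta> fin (\<sigma>, T, printed u) = (\<sigma>', T', printed u')" "\<sigma>' \<in> states"
      using inv[OF Suc.prems] by blast
    show ?case by (simp only: funpow_Suc_right o_apply step[OF Suc.prems] n(1) Suc.IH[OF n(2)])
  qed simp
  have init: "init_config M w = conf (start, tape_at w 0, printed [])" for w
    by (simp add: init_config_def M_def conf_def tape_at_def printed_def code_def numeral_2_eq_2
        word_cells_def fun_eq_iff)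
  have "outputs_within M w v (m * ((bound + 2) * Suc (length w)))" if sw: "sweeps \<delta> fin m q0 w v" for w v m
  proof -
    obtain s T where s: "s \<le> m * ((bound + 2) * Suc (length w))"
      "(sweep_step \<delta> fin ^^ s) (start, tape_at w 0, printed []) = (halt, T, printed v)"
      using run_sweeps[OF sw sweep_machine.start[OF sweep_machine_axioms], of "[]"] by (auto simp: start_def halt_def)
    have "(step M ^^ s) (init_config M w) = conf (halt, T, printed v)"
      by (simp only: init steps[OF sh(1)] s(2))
    moreover have "case conf (halt, T, printed v) of (q, ts) \<Rightarrow> q = num_states M \<and> fst (ts ! 1) = word_cells v"
      using sh(3) by (simp add: conf_def M_def code_def printed_def)
    ultimately show ?thesis
      unfolding outputs_within_def using s(1) by (intro exI[of _ s]) simp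
  qed
  note out = this
  have mono: "outputs_within M w v t'" if "outputs_within M w v t" "t \<le> t'" for w v t t'
    using that unfolding outputs_within_def by (elim exE conjE) (rule exI, rule conjI, erule le_trans)
  define p where "p = r * [:bound + 2, bound + 2:]"
  have p: "poly p n = poly r n * ((bound + 2) * Suc n)" for n
    unfolding p_def by (simp only: poly_mult poly_pCons poly_0) simp
  have "outputs_within M (encode A x) (encode B (g x)) (poly p (length (encode A x)))"
    if "x \<in> instances A" for x
  proof -
    obtain m where m: "m \<le> poly r (length (encode A x))" "sweeps \<delta> fin m q0 (encode A x) (encode B (g x))"
      using run[OF \<open>x \<in> instances A\<close>] by blast
    show ?thesis
      by (rule mono[OF out[OF m(2)]]) (simp only: p mult_le_mono1[OF m(1)])
  qed
  then show ?thesis using wf unfolding poly_time_computable_def by blast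
qed

end

section \<open>Evaluating monomials and polynomials\<close>

text \<open>Exponent vectors are built by concatenating blocks, so a list product, which splits over
  appends, replaces the indexed one.\<close>

lemma eval_monomial_eq:
  "length es = length x \<Longrightarrow> eval_monomial (c, es) x = of_int c * prod_list (map2 (^) x es)"
proof -
  assume l: "length es = length x"
  have "(\<Prod>i < length es. x ! i ^ (es ! i)) = prod_list (map2 (^) x es)"
    using l by (induction es x rule: list_induct2) (simp_all add: prod.lessThan_Suc_shift del: prod.lessThan_Suc)
  then show ?thesis by simp
qed

lemma eval_Nil [simp]: "eval [] x = 0"
  by (simp add: eval_def)

lemma eval_Cons [simp]: "eval (m # f) x = eval_monomial m x + eval f x"
  by (simp add: eval_def)

lemma eval_append: "eval (f @ g) x = eval f x + eval g x"
  by (simp add: eval_def)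

lemma prod_list_power_zeros: "prod_list (map2 (^) x (replicate n 0)) = (1::real)"
  by (induction x arbitrary: n) (case_tac n; simp)+

section \<open>VSC is in \<open>\<exists>\<real>\<close>\<close>

definition spread :: "nat \<Rightarrow> nat \<Rightarrow> nat list" where
  "spread j e = replicate j 0 @ e # replicate (2 - j) 0"

text \<open>The variables are p_k, q_k, m_k for each coordinate k, followed by t. Copy 0, 1, 2 of f
  uses p, q and the midpoint m; the final exponent 0 belongs to t.\<close>

definition embed :: "nat \<Rightarrow> monomial \<Rightarrow> monomial" where
  "embed j = (\<lambda>(c, es). (c, concat (map (spread j) es) @ [0]))"

definition const_exps :: "nat \<Rightarrow> nat \<Rightarrow> nat list" where
  "const_exps d e = replicate (3 * d) 0 @ [e]"

definition unit_exps :: "nat \<Rightarrow> nat \<Rightarrow> nat \<Rightarrow> nat list" where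
  "unit_exps j d k = concat (replicate k [0, 0, 0]) @ spread j 1 @ concat (replicate (d - Suc k) [0, 0, 0]) @ [0]"

text \<open>The monomial -t comes first so that its exponents can be printed while the sweep still
  reads the unary dimension.\<close>

definition cluster :: "nat \<Rightarrow> nat \<Rightarrow> mpolynomial \<Rightarrow> qf_formula" where
  "cluster j d f = Negative ((- 1, const_exps d 1) # map (embed j) f)"

text \<open>\<open>r\<close> coordinates remain and the next one is d - r, so the conjuncts follow
  the order in which a machine marks coordinates from the left. \<open>Zero []\<close> is the true
  formula.\<close>

fun midpoint_formula :: "nat \<Rightarrow> nat \<Rightarrow> qf_formula" where
  "midpoint_formula d 0 = Zero []"
| "midpoint_formula d (Suc r) =
     Conj (Zero [(1, unit_exps 0 d (d - Suc r)), (1, unit_exps 1 d (d - Suc r)), (- 2, unit_exps 2 d (d - Suc r))])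
       (midpoint_formula d r)"

text \<open>Multiplying f by the denominator of \<theta> would need arithmetic on binary
  coefficients; the variable t lets numerator and denominator be copied verbatim.\<close>

fun vsc_formula :: "nat \<times> mpolynomial \<times> rat \<Rightarrow> qf_formula" where
  "vsc_formula (d, f, \<theta>) =
     Conj (Zero [(- fst (quotient_of \<theta>), const_exps d 0), (snd (quotient_of \<theta>), const_exps d 1)])
       (Conj (Neg (cluster 0 d f)) (Conj (Neg (cluster 1 d f)) (Conj (cluster 2 d f) (midpoint_formula d d))))"

definition flat :: "(nat \<Rightarrow> real) list \<Rightarrow> real list" where
  "flat ts = concat (map (\<lambda>t. [t 0, t 1, t 2]) ts)"

lemma length_flat [simp]: "length (flat ts) = 3 * length ts"
  by (induction ts) (auto simp: flat_def)

lemma flat_exists: "length v = 3 * d + 1 \<Longrightarrow> \<exists>ts t. length ts = d \<and> v = flat ts @ [t]"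
proof (induction d arbitrary: v)
  case 0
  then show ?case by (auto simp: flat_def length_Suc_conv)
next
  case (Suc d)
  then obtain a b c v' where v: "v = a # b # c # v'" "length v' = 3 * d + 1"
    by (auto simp: length_Suc_conv eval_nat_numeral)
  obtain ts t where ts: "length ts = d" "v' = flat ts @ [t]" using Suc.IH[OF v(2)] by auto
  have "v = flat ((\<lambda>i. [a, b, c] ! i) # ts) @ [t]"
    using v ts by (simp add: flat_def numeral_2_eq_2)
  then show ?case using ts by (intro exI[of _ "(\<lambda>i. [a, b, c] ! i) # ts"]) auto
qed

lemma less_3_cases: "j < 3 \<Longrightarrow> (j = 0 \<Longrightarrow> P) \<Longrightarrow> (j = 1 \<Longrightarrow> P) \<Longrightarrow> (j = 2 \<Longrightarrow> P) \<Longrightarrow> P" for j :: nat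
  by linarith

lemma length_spread [simp]: "j < 3 \<Longrightarrow> length (spread j e) = 3"
  by (auto simp: spread_def)

lemma length_embed_exps [simp]: "j < 3 \<Longrightarrow> length (concat (map (spread j) es)) = 3 * length es"
  by (induction es) auto

lemma length_concat_zeros: "length (concat (replicate k [0, 0, 0 :: nat])) = 3 * k"
  by (induction k) auto

lemma power_spread:
  "j < 3 \<Longrightarrow> prod_list (map2 (^) (t 0 # t 1 # t 2 # x) (spread j e @ es)) = t j ^ e * prod_list (map2 (^) x es)"
  for t :: "nat \<Rightarrow> real"
  by (erule less_3_cases) (simp_all add: spread_def numeral_2_eq_2)

lemma power_embed:
  assumes "j < 3" "length es = length ts"
  shows "prod_list (map2 (^) (flat ts @ [t]) (concat (map (spread j) es) @ [0])) =
     prod_list (map2 (^) (map (\<lambda>t. t j) ts) es)"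
  using assms(2)
proof (induction es ts rule: list_induct2)
  case (Cons e es s ts)
  then show ?case using power_spread[OF assms(1), of s] by (simp add: flat_def)
qed (simp add: flat_def)

lemma eval_embed:
  assumes "j < 3" "in_vars (length ts) f"
  shows "eval (map (embed j) f) (flat ts @ [t]) = eval f (map (\<lambda>t. t j) ts)"
  using assms(2)
proof (induction f)
  case (Cons m f)
  obtain c es where m: "m = (c, es)" by (cases m)
  have l: "length es = length ts" using Cons.prems m by (simp add: in_vars_def)
  have "eval_monomial (embed j m) (flat ts @ [t]) = eval_monomial m (map (\<lambda>t. t j) ts)"
    using assms(1) l power_embed[OF assms(1) l] by (simp add: m embed_def eval_monomial_eq del: eval_monomial.simps)
  then show ?case using Cons by (simp add: in_vars_def)
qed simp

lemma eval_const_exps: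
  "eval_monomial (c, const_exps (length ts) e) (flat ts @ [t]) = of_int c * t ^ e"
proof -
  have "map2 (^) (flat ts @ [t]) (const_exps (length ts) e)
     = map2 (^) (flat ts) (replicate (3 * length ts) 0) @ [t ^ e]"
    by (simp add: const_exps_def)
  then show ?thesis
    by (simp add: eval_monomial_eq const_exps_def prod_list_power_zeros del: eval_monomial.simps)
qed

lemma eval_unit_exps:
  assumes "j < 3" "k < length ts"
  shows "eval_monomial (c, unit_exps j (length ts) k) (flat ts @ [t]) = of_int c * (ts ! k) j"
proof -
  have z: "prod_list (map2 (^) (flat ts @ x) (concat (replicate (length ts) [0, 0, 0]) @ es))
     = prod_list (map2 (^) x es)" for ts x and es :: "nat list"
    by (induction ts) (auto simp: flat_def)
  obtain us s vs where ts: "ts = us @ s # vs" "length us = k"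
    using id_take_nth_drop[OF assms(2)] assms(2) by (metis length_take min.absorb4)
  have "prod_list (map2 (^) (flat ts @ [t]) (unit_exps j (length ts) k)) = (ts ! k) j"
    using ts z[of us] z[of vs "[t]" "[0]"] power_spread[OF assms(1), of s _ 1]
    by (auto simp: unit_exps_def flat_def)
  then show ?thesis
    using assms by (simp add: eval_monomial_eq unit_exps_def length_concat_zeros del: eval_monomial.simps)
qed

lemma holds_midpoint_formula:
  "r \<le> length ts \<Longrightarrow> holds (midpoint_formula (length ts) r) (flat ts @ [t]) \<longleftrightarrow>
     (\<forall>k<length ts. length ts - r \<le> k \<longrightarrow> (ts ! k) 0 + (ts ! k) 1 = 2 * (ts ! k) 2)"
proof (induction r)
  case 0
  show ?case by (simp add: leD)
next
  case (Suc r)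
  let ?n = "length ts"
  define k0 where "k0 = ?n - Suc r"
  have k0: "k0 < ?n" "?n - r = Suc k0" using Suc.prems by (auto simp: k0_def)
  have 1: "holds (midpoint_formula ?n (Suc r)) (flat ts @ [t]) \<longleftrightarrow>
      (ts ! k0) 0 + (ts ! k0) 1 = 2 * (ts ! k0) 2 \<and> holds (midpoint_formula ?n r) (flat ts @ [t])"
    unfolding midpoint_formula.simps k0_def[symmetric]
    using k0(1) by (simp add: eval_unit_exps del: eval_monomial.simps) linarith
  have "holds (midpoint_formula ?n r) (flat ts @ [t]) \<longleftrightarrow>
     (\<forall>k<?n. Suc k0 \<le> k \<longrightarrow> (ts ! k) 0 + (ts ! k) 1 = 2 * (ts ! k) 2)"
    using Suc.IH Suc.prems k0(2) by simp
  then show ?case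
    unfolding 1 k0_def[symmetric] using k0(1) by (auto simp: Suc_le_eq le_less)
qed

lemma vsc_formula_in_vars:
  assumes "in_vars d f"
  shows "formula_in_vars (3 * d + 1) (vsc_formula (d, f, \<theta>))"
proof -
  have "formula_in_vars (3 * d + 1) (midpoint_formula d r)" if "r \<le> d" for r
    using that by (induction r) (auto simp: in_vars_def unit_exps_def length_concat_zeros)
  moreover have "formula_in_vars (3 * d + 1) (cluster j d f)" if "j < 3" for j
    using assms that by (auto simp: cluster_def in_vars_def embed_def const_exps_def split: prod.splits)
  ultimately show ?thesis by (simp add: in_vars_def const_exps_def)
qed

lemma vsc_formula_correct:
  assumes f: "in_vars d f"
  shows "(\<exists>v. length v = 3 * d + 1 \<and> holds (vsc_formula (d, f, \<theta>)) v) \<longleftrightarrow>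
    (\<exists>p q. length p = d \<and> length q = d \<and> eval f p \<ge> of_rat \<theta> \<and> eval f q \<ge> of_rat \<theta> \<and>
              eval f (midpoint_list p q) < of_rat \<theta>)"
proof -
  obtain a b where ab: "quotient_of \<theta> = (a, b)" by (cases "quotient_of \<theta>")
  have b: "b > 0" using quotient_of_denom_pos[OF ab] .
  have \<theta>: "of_rat \<theta> = (of_int a / of_int b :: real)"
    by (subst quotient_of_div[OF ab]) (simp add: of_rat_divide)
  have holds: "holds (vsc_formula (d, f, \<theta>)) (flat ts @ [t]) \<longleftrightarrow>
      t = of_rat \<theta> \<and> eval f (map (\<lambda>t. t 0) ts) \<ge> t \<and> eval f (map (\<lambda>t. t 1) ts) \<ge> t \<and>
      eval f (map (\<lambda>t. t 2) ts) < t \<and> (\<forall>k<d. (ts ! k) 0 + (ts ! k) 1 = 2 * (ts ! k) 2)"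
    if "length ts = d" for ts t
  proof -
    have "holds (Zero [(- a, const_exps d 0), (b, const_exps d 1)]) (flat ts @ [t]) \<longleftrightarrow> of_int b * t = of_int a"
      by (simp add: eval_const_exps[of _ ts, unfolded that] del: eval_monomial.simps)
    also have "\<dots> \<longleftrightarrow> t = of_rat \<theta>" unfolding \<theta> using b by (simp add: nonzero_eq_divide_eq mult.commute)
    finally have 1: "holds (Zero [(- a, const_exps d 0), (b, const_exps d 1)]) (flat ts @ [t]) \<longleftrightarrow> t = of_rat \<theta>" .
    have 2: "holds (cluster j d f) (flat ts @ [t]) \<longleftrightarrow> eval f (map (\<lambda>s. s j) ts) < t" if "j < 3" for j
      using eval_embed[OF \<open>j < 3\<close>, of ts f t] f
      by (simp add: cluster_def eval_const_exps[of _ ts, unfolded \<open>length ts = d\<close>] \<open>length ts = d\<close> del: eval_monomial.simps)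
    have 3: "holds (midpoint_formula d d) (flat ts @ [t]) \<longleftrightarrow> (\<forall>k<d. (ts ! k) 0 + (ts ! k) 1 = 2 * (ts ! k) 2)"
      using holds_midpoint_formula[of d ts t] that by simp
    show ?thesis
      unfolding vsc_formula.simps ab fst_conv snd_conv holds.simps(4-6) 1 3
      by (simp only: 2 not_less)
  qed
  show ?thesis
  proof
    assume "\<exists>v. length v = 3 * d + 1 \<and> holds (vsc_formula (d, f, \<theta>)) v"
    then obtain ts t where ts: "length ts = d" and h: "holds (vsc_formula (d, f, \<theta>)) (flat ts @ [t])"
      using flat_exists by metis
    have "midpoint_list (map (\<lambda>t. t 0) ts) (map (\<lambda>t. t 1) ts) = map (\<lambda>t. t 2) ts"
      using h ts unfolding holds[OF ts] by (intro nth_equalityI) (auto simp: midpoint_list_def)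
    then show "\<exists>p q. length p = d \<and> length q = d \<and> eval f p \<ge> of_rat \<theta> \<and> eval f q \<ge> of_rat \<theta> \<and>
              eval f (midpoint_list p q) < of_rat \<theta>"
      using h ts unfolding holds[OF ts]
      by (intro exI[of _ "map (\<lambda>t. t 0) ts"] exI[of _ "map (\<lambda>t. t 1) ts"]) auto
  next
    assume "\<exists>p q. length p = d \<and> length q = d \<and> eval f p \<ge> of_rat \<theta> \<and> eval f q \<ge> of_rat \<theta> \<and>
              eval f (midpoint_list p q) < of_rat \<theta>"
    then obtain p q where pq: "length p = d" "length q = d" "eval f p \<ge> of_rat \<theta>" "eval f q \<ge> of_rat \<theta>"
              "eval f (midpoint_list p q) < of_rat \<theta>" by blast
    define ts where "ts = map (\<lambda>k j. [p ! k, q ! k, midpoint_list p q ! k] ! j) [0..<d]"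
    have ts: "length ts = d" "map (\<lambda>t. t 0) ts = p" "map (\<lambda>t. t 1) ts = q" "map (\<lambda>t. t 2) ts = midpoint_list p q"
      using pq(1,2) by (auto simp: ts_def midpoint_list_def numeral_2_eq_2 intro!: nth_equalityI)
    have "\<forall>k<d. (ts ! k) 0 + (ts ! k) 1 = 2 * (ts ! k) 2"
      using pq(1,2) by (auto simp: ts_def midpoint_list_def numeral_2_eq_2)
    then have "holds (vsc_formula (d, f, \<theta>)) (flat ts @ [of_rat \<theta>])"
      unfolding holds[OF ts(1)] ts using pq by simp
    then show "\<exists>v. length v = 3 * d + 1 \<and> holds (vsc_formula (d, f, \<theta>)) v"
      using ts(1) by (intro exI[of _ "flat ts @ [of_rat \<theta>]"] conjI) simp_all
  qed
qed

section \<open>A sweep machine that prints this sentence\<close>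

definition blocks :: "nat list \<Rightarrow> string" where
  "blocks es = concat (map (\<lambda>e. CHR ''x'' # replicate e (CHR ''1'')) es)"

lemma blocks_append [simp]: "blocks (es @ fs) = blocks es @ blocks fs"
  by (simp add: blocks_def)

lemma blocks_Cons [simp]: "blocks (e # es) = CHR ''x'' # replicate e (CHR ''1'') @ blocks es"
  by (simp add: blocks_def)

lemma blocks_Nil [simp]: "blocks [] = []"
  by (simp add: blocks_def)

lemma blocks_zeros [simp]: "blocks (replicate n 0) = replicate n (CHR ''x'')"
  by (induction n) auto

lemma enc_monomial_eq: "enc_monomial (c, es) = enc_int c @ blocks es"
  by (simp add: blocks_def)

lemma enc_poly_Nil [simp]: "enc_poly [] = []"
  by (simp add: enc_poly_def)

lemma enc_poly_Cons [simp]: "enc_poly ((c, es) # f) = enc_int c @ blocks es @ '';'' @ enc_poly f"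
  by (simp add: enc_poly_def enc_monomial_eq del: enc_monomial.simps)

lemma enc_poly_append [simp]: "enc_poly (f @ g) = enc_poly f @ enc_poly g"
  by (simp add: enc_poly_def)

lemma enc_int_small [simp]: "enc_int 1 = ''1''" "enc_int (- 1) = ''-1''" "enc_int (- 2) = ''-10''"
  by (simp_all add: enc_int_def binary.simps digit_def)

datatype stage = Dim | Numer | PadN | Denom | PadD | Clus nat | Find | Mid nat

text \<open>A state consists of the stage, the number of separators passed, and a flag.  The stage \<open>Clus j\<close>
  prints the constraint for the copy \<open>j\<close> of \<open>f\<close>.  The stages \<open>Find\<close> and \<open>Mid\<close> handle one coordinate of the
  midpoint at a time, and \<open>Mid 2\<close> marks it as done by \<open>D\<close>.\<close>

type_synonym vsc_state = "stage \<times> nat \<times> bool"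

text \<open>The count \<open>s\<close> locates the head: 0 in the dimension, 1 in f, 2 in the
  numerator, 3 in the denominator. In \<open>Clus j\<close> the flag records an open exponent block.
  Its 2 - j trailing zero blocks must follow the tally, so they are printed late: at the next
  \<open>x\<close>, where together with the j + 1 blocks of the new coordinate they make
  \<open>xxx\<close>, or at \<open>;\<close>.\<close>

fun vsc_out :: "vsc_state \<Rightarrow> char \<Rightarrow> string" where
  "vsc_out (Numer, s, b) c = (if s = 2 \<and> c \<noteq> CHR ''/'' then [c] else [])"
| "vsc_out (Denom, s, b) c = (if s = 3 then [c] else [])"
| "vsc_out (Find, s, b) c = []"
| "vsc_out (Mid j, s, b) c =
     (if s > 0 \<or> c = CHR ''#'' then []
      else if c = CHR ''x'' \<and> \<not> b then replicate (Suc j) (CHR ''x'') @ ''1'' @ replicate (2 - j) (CHR ''x'')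
      else ''xxx'')"
| "vsc_out (Clus j, s, b) c =
     (if s = 0 then (if c = CHR ''#'' then ''x1;'' else ''xxx'')
      else if s > 1 then []
      else if c = CHR ''#'' then ''.''
      else if c = CHR ''x'' then (if b then ''xxx'' else replicate (Suc j) (CHR ''x''))
      else if c = CHR '';'' then (if b then replicate (2 - j) (CHR ''x'') else []) @ ''x;''
      else [c])"
| "vsc_out (k, s, b) c = (if s = 0 \<and> c \<noteq> CHR ''#'' then ''xxx'' else [])"

text \<open>Outside \<open>Clus\<close> the flag says that an unmarked coordinate has been met:
  \<open>Find\<close> thereby learns whether any is left, and \<open>Mid\<close> treats only the
  leftmost one.\<close>

fun vsc_flag :: "vsc_state \<Rightarrow> char \<Rightarrow> bool" where
  "vsc_flag (Clus j, s, b) c = (s = 1 \<and> (c = CHR ''x'' \<or> (b \<and> c \<noteq> CHR '';'')))"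
| "vsc_flag (k, s, b) c = (b \<or> (s = 0 \<and> c = CHR ''x''))"

definition sep :: "char \<Rightarrow> bool" where
  "sep c \<longleftrightarrow> c = CHR ''#'' \<or> c = CHR ''/''"

fun vsc_delta :: "vsc_state \<Rightarrow> char \<Rightarrow> vsc_state \<times> char \<times> string" where
  "vsc_delta (k, s, b) c =
     ((k, if sep c then min 3 (Suc s) else s, vsc_flag (k, s, b) c),
      if k = Mid 2 \<and> s = 0 \<and> c = CHR ''x'' \<and> \<not> b then CHR ''D'' else c,
      vsc_out (k, s, b) c)"

fun vsc_fin :: "vsc_state \<Rightarrow> string \<times> vsc_state option" where
  "vsc_fin (Dim, s, b) = (''x#&=-'', Some (Numer, 0, False))"
| "vsc_fin (Numer, s, b) = ([], Some (PadN, 0, False))"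
| "vsc_fin (PadN, s, b) = (''x;'', Some (Denom, 0, False))"
| "vsc_fin (Denom, s, b) = ([], Some (PadD, 0, False))"
| "vsc_fin (PadD, s, b) = (''x1;.&~<-1'', Some (Clus 0, 0, False))"
| "vsc_fin (Clus j, s, b) =
     (if j = 0 then (''&~<-1'', Some (Clus 1, 0, False))
      else if j = 1 then (''&<-1'', Some (Clus 2, 0, False))
      else ([], Some (Find, 0, False)))"
| "vsc_fin (Find, s, b) = (if b then (''&=1'', Some (Mid 0, 0, False)) else (''=.'', None))"
| "vsc_fin (Mid j, s, b) =
     (if j = 0 then (''x;1'', Some (Mid 1, 0, False))
      else if j = 1 then (''x;-10'', Some (Mid 2, 0, False))
      else (''x;.'', Some (Find, 0, False)))"

definition vsc_states :: "vsc_state set" where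
  "vsc_states = ({Dim, Numer, PadN, Denom, PadD, Find} \<union> Clus ` {..2} \<union> Mid ` {..2}) \<times> {..3} \<times> UNIV"

lemma vsc_machine: "sweep_machine vsc_delta vsc_fin vsc_states (Dim, 0, False)"
proof
  show "finite vsc_states" by (auto simp: vsc_states_def)
  show "(Dim, 0, False) \<in> vsc_states" by (auto simp: vsc_states_def)
  show "fst (vsc_delta q c) \<in> vsc_states" if "q \<in> vsc_states" for q c
    using that by (cases q) (auto simp: vsc_states_def)
  show "q' \<in> vsc_states" if "q \<in> vsc_states" "vsc_fin q = (e, Some q')" for q e q'
    using that(2) by (cases q rule: vsc_fin.cases) (auto simp: vsc_states_def split: if_splits)
qed

definition tape_word :: "nat \<Rightarrow> nat \<Rightarrow> string \<Rightarrow> string \<Rightarrow> string \<Rightarrow> string" where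
  "tape_word k r P A B = replicate k (CHR ''D'') @ replicate r (CHR ''x'') @ ''#'' @ P @ ''#'' @ A @ ''/'' @ B"

definition no_sep :: "string \<Rightarrow> bool" where
  "no_sep w \<longleftrightarrow> (\<forall>c\<in>set w. \<not> sep c)"

lemma pass_quiet:
  assumes "k \<in> {Dim, PadN, PadD, Find, Mid j}"
  shows "s > 0 \<Longrightarrow> \<exists>s'. pass vsc_delta (k, s, b) w = ((k, s', b), w, [])"
proof (induction w arbitrary: s)
  case (Cons c w)
  have *: "(if sep c then min 3 (Suc s) else s) > 0" using Cons.prems by auto
  have "vsc_delta (k, s, b) c = ((k, if sep c then min 3 (Suc s) else s, b), c, [])"
    using assms Cons.prems by auto
  then show ?case using Cons.IH[OF *] by auto
qed simp

lemma pass_pad_prefix: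
  "k \<in> {Dim, PadN, PadD} \<Longrightarrow>
   pass vsc_delta (k, 0, b) (replicate n (CHR ''x'')) =
     ((k, 0, b \<or> n > 0), replicate n (CHR ''x''), replicate (3 * n) (CHR ''x''))"
  by (induction n arbitrary: b) (auto simp: sep_def numeral_3_eq_3)

lemma pass_pad:
  assumes "k \<in> {Dim, PadN, PadD}"
  shows "\<exists>s b. pass vsc_delta (k, 0, False) (tape_word 0 d P A B) =
     ((k, s, b), tape_word 0 d P A B, replicate (3 * d) (CHR ''x''))"
proof -
  obtain s where "pass vsc_delta (k, 1, d > 0) (P @ ''#'' @ A @ ''/'' @ B) =
      ((k, s, d > 0), P @ ''#'' @ A @ ''/'' @ B, [])"
    using pass_quiet[of k 0 1 "d > 0" "P @ ''#'' @ A @ ''/'' @ B"] assms by auto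
  moreover have "vsc_delta (k, 0, d > 0) (CHR ''#'') = ((k, 1, d > 0), CHR ''#'', [])"
    using assms by (auto simp: sep_def)
  ultimately show ?thesis
    using pass_pad_prefix[OF assms, of False d] by (auto simp: tape_word_def pass_append simp del: vsc_delta.simps)
qed

lemma pass_Numer:
  "no_sep w \<Longrightarrow> s > 0 \<Longrightarrow> pass vsc_delta (Numer, s, b) w = ((Numer, s, b), w, if s = 2 then w else [])"
  by (induction w) (auto simp: no_sep_def sep_def)

lemma pass_Denom:
  "no_sep w \<Longrightarrow> s > 0 \<Longrightarrow> pass vsc_delta (Denom, s, b) w = ((Denom, s, b), w, if s = 3 then w else [])"
  by (induction w) (auto simp: no_sep_def sep_def)

lemma pass_silent_prefix:
  "k \<in> {Numer, Denom} \<Longrightarrow>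
   pass vsc_delta (k, 0, b) (replicate n (CHR ''x'')) = ((k, 0, b \<or> n > 0), replicate n (CHR ''x''), [])"
  by (induction n arbitrary: b) (auto simp: sep_def)

lemma pass_number:
  assumes "no_sep P" "no_sep A" "no_sep B"
  shows "\<exists>s b. pass vsc_delta (Numer, 0, False) (tape_word 0 d P A B) = ((Numer, s, b), tape_word 0 d P A B, A)"
    and "\<exists>s b. pass vsc_delta (Denom, 0, False) (tape_word 0 d P A B) = ((Denom, s, b), tape_word 0 d P A B, B)"
  using assms
  by (simp_all add: tape_word_def pass_append pass_silent_prefix pass_Numer pass_Denom sep_def numeral_2_eq_2 numeral_3_eq_3)

lemma pass_Clus_prefix:
  "pass vsc_delta (Clus j, 0, False) (replicate n (CHR ''x'')) =
     ((Clus j, 0, False), replicate n (CHR ''x''), replicate (3 * n) (CHR ''x''))"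
  by (induction n) (auto simp: sep_def numeral_3_eq_3)

lemma pass_Clus_end: "s > 1 \<Longrightarrow> \<exists>s'. pass vsc_delta (Clus j, s, False) w = ((Clus j, s', False), w, [])"
proof (induction w arbitrary: s)
  case (Cons c w)
  have *: "(if sep c then min 3 (Suc s) else s) > 1" using Cons.prems by auto
  have "vsc_delta (Clus j, s, False) c = ((Clus j, if sep c then min 3 (Suc s) else s, False), c, [])"
    using Cons.prems by auto
  then show ?case using Cons.IH[OF *] by auto
qed simp

lemma pass_Clus_copy:
  "set w \<subseteq> {CHR ''-'', CHR ''0'', CHR ''1''} \<Longrightarrow>
   pass vsc_delta (Clus j, 1, b) w = ((Clus j, 1, b), w, w)"
  by (induction w) (auto simp: sep_def)

text \<open>The induction also has to start inside an open block; \<open>b\<close> accounts for the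
  zeros still owed to it.\<close>

lemma pass_Clus_blocks:
  "j < 3 \<Longrightarrow> pass vsc_delta (Clus j, 1, b) (blocks es @ '';'') = ((Clus j, 1, False), blocks es @ '';'',
     (if b then replicate (2 - j) (CHR ''x'') else []) @ blocks (concat (map (spread j) es) @ [0]) @ '';'')"
proof (induction es arbitrary: b)
  case Nil
  show ?case by (simp add: sep_def)
next
  case (Cons e es)
  have c: "pass vsc_delta (Clus j, 1, True) (replicate e (CHR ''1'')) =
      ((Clus j, 1, True), replicate e (CHR ''1''), replicate e (CHR ''1''))"
    by (rule pass_Clus_copy) auto
  show ?case
    using Cons.IH[of True] c Cons.prems pass_append_eq[OF c Cons.IH[OF Cons.prems, of True]]
    by (auto simp: sep_def spread_def less_Suc_eq numeral_3_eq_3 numeral_2_eq_2 split: if_splits)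
qed

lemma pass_Clus_poly:
  "j < 3 \<Longrightarrow> pass vsc_delta (Clus j, 1, False) (enc_poly f) = ((Clus j, 1, False), enc_poly f, enc_poly (map (embed j) f))"
proof (induction f)
  case (Cons m f)
  obtain c es where m: "m = (c, es)" by (cases m)
  show ?case
    using pass_append_eq[OF pass_Clus_copy[OF set_enc_int] pass_append_eq[OF pass_Clus_blocks[OF Cons.prems] Cons.IH[OF Cons.prems]]]
    by (simp add: m embed_def)
qed simp

lemma pass_Clus:
  assumes "j < 3"
  shows "\<exists>s. pass vsc_delta (Clus j, 0, False) (tape_word 0 d (enc_poly f) A B) =
     ((Clus j, s, False), tape_word 0 d (enc_poly f) A B,
      replicate (3 * d) (CHR ''x'') @ ''x1;'' @ enc_poly (map (embed j) f) @ ''.'')"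
proof -
  obtain s where "pass vsc_delta (Clus j, 2, False) (A @ ''/'' @ B) = ((Clus j, s, False), A @ ''/'' @ B, [])"
    using pass_Clus_end[of 2] by auto
  then show ?thesis
    using pass_Clus_poly[OF assms, of f]
    by (simp add: tape_word_def pass_append pass_Clus_prefix sep_def numeral_2_eq_2)
qed

lemma pass_Find_prefix:
  "pass vsc_delta (Find, 0, b) (replicate k (CHR ''D'') @ replicate r (CHR ''x'')) =
     ((Find, 0, b \<or> r > 0), replicate k (CHR ''D'') @ replicate r (CHR ''x''), [])"
proof -
  have "pass vsc_delta (Find, 0, b) (replicate r (CHR ''x'')) = ((Find, 0, b \<or> r > 0), replicate r (CHR ''x''), [])" for b
    by (induction r arbitrary: b) (auto simp: sep_def)
  moreover have "pass vsc_delta (Find, 0, b) (replicate k (CHR ''D'')) = ((Find, 0, b), replicate k (CHR ''D''), [])"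
    by (induction k) (auto simp: sep_def)
  ultimately show ?thesis by (simp add: pass_append)
qed

lemma pass_Find:
  "\<exists>s. pass vsc_delta (Find, 0, False) (tape_word k r P A B) = ((Find, s, r > 0), tape_word k r P A B, [])"
proof -
  obtain s where "pass vsc_delta (Find, 1, r > 0) (P @ ''#'' @ A @ ''/'' @ B) =
      ((Find, s, r > 0), P @ ''#'' @ A @ ''/'' @ B, [])"
    using pass_quiet[of Find 0 1 "r > 0" "P @ ''#'' @ A @ ''/'' @ B"] by auto
  then have "pass vsc_delta (Find, 0, r > 0) (''#'' @ P @ ''#'' @ A @ ''/'' @ B) =
      ((Find, s, r > 0), ''#'' @ P @ ''#'' @ A @ ''/'' @ B, [])"
    by (simp add: sep_def del: append_eq_append_conv2 append_eq_Cons_conv)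
  then have "pass vsc_delta (Find, 0, False \<or> r > 0) (''#'' @ P @ ''#'' @ A @ ''/'' @ B) =
      ((Find, s, r > 0), ''#'' @ P @ ''#'' @ A @ ''/'' @ B, [])" by simp
  from pass_append_eq[OF pass_Find_prefix this, of k]
  show ?thesis by (simp add: tape_word_def)
qed

lemma pass_Mid_done:
  "pass vsc_delta (Mid j, 0, False) (replicate k (CHR ''D'')) =
     ((Mid j, 0, False), replicate k (CHR ''D''), replicate (3 * k) (CHR ''x''))"
  by (induction k) (auto simp: sep_def numeral_3_eq_3)

lemma pass_Mid_rest:
  "pass vsc_delta (Mid j, 0, True) (replicate r (CHR ''x'')) =
     ((Mid j, 0, True), replicate r (CHR ''x''), replicate (3 * r) (CHR ''x''))"
  by (induction r) (auto simp: sep_def numeral_3_eq_3)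

lemma pass_Mid:
  "\<exists>s b. pass vsc_delta (Mid j, 0, False) (tape_word k (Suc r) P A B) =
     ((Mid j, s, b), if j = 2 then tape_word (Suc k) r P A B else tape_word k (Suc r) P A B,
      replicate (3 * k) (CHR ''x'') @ blocks (spread j 1) @ replicate (3 * r) (CHR ''x''))"
proof -
  obtain s where "pass vsc_delta (Mid j, 1, True) (P @ ''#'' @ A @ ''/'' @ B) =
      ((Mid j, s, True), P @ ''#'' @ A @ ''/'' @ B, [])"
    using pass_quiet[of "Mid j" j 1 True "P @ ''#'' @ A @ ''/'' @ B"] by auto
  then have 1: "pass vsc_delta (Mid j, 0, True) (''#'' @ P @ ''#'' @ A @ ''/'' @ B) =
      ((Mid j, s, True), ''#'' @ P @ ''#'' @ A @ ''/'' @ B, [])"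
    by (simp add: sep_def)
  have 2: "pass vsc_delta (Mid j, 0, False) ''x'' =
      ((Mid j, 0, True), if j = 2 then ''D'' else ''x'', blocks (spread j 1))"
    by (simp add: sep_def spread_def replicate_append_same[symmetric])
  have 3: "replicate k (CHR ''D'') @ CHR ''D'' # w = CHR ''D'' # replicate k (CHR ''D'') @ w" for w
    by (induction k) auto
  show ?thesis
    using pass_append_eq[OF pass_Mid_done[of j k] pass_append_eq[OF 2 pass_append_eq[OF pass_Mid_rest[of j r] 1]]]
    by (intro exI[of _ s] exI[of _ True]) (simp add: tape_word_def 3)
qed

lemma vsc_fin_Clus:
  "vsc_fin (Clus 0, s, b) = (''&~<-1'', Some (Clus 1, 0, False))"
  "vsc_fin (Clus 1, s, b) = (''&<-1'', Some (Clus 2, 0, False))"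
  "vsc_fin (Clus 2, s, b) = ([], Some (Find, 0, False))"
  by simp_all

lemma vsc_fin_Find: "vsc_fin (Find, s, True) = (''&=1'', Some (Mid 0, 0, False))"
  by simp

lemma vsc_fin_Mid:
  "vsc_fin (Mid 0, s, b) = (''x;1'', Some (Mid 1, 0, False))"
  "vsc_fin (Mid 1, s, b) = (''x;-10'', Some (Mid 2, 0, False))"
  "vsc_fin (Mid 2, s, b) = (''x;.'', Some (Find, 0, False))"
  by simp_all

lemma blocks_unit_exps:
  "blocks (unit_exps j d k) =
     replicate (3 * k) (CHR ''x'') @ blocks (spread j 1) @ replicate (3 * (d - Suc k)) (CHR ''x'') @ ''x''"
proof -
  have "blocks (concat (replicate k [0, 0, 0])) = replicate (3 * k) (CHR ''x'')" for k
    by (induction k) (auto simp: numeral_3_eq_3)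
  then show ?thesis by (simp add: unit_exps_def)
qed

text \<open>A coordinate takes one sweep to find it and one for each of the terms p_k, q_k and -2
  m_k; a last \<open>Find\<close> meets no unmarked coordinate and stops.\<close>

lemma sweeps_midpoint:
  "sweeps vsc_delta vsc_fin (4 * r + 1) (Find, 0, False) (tape_word k r P A B) (enc_formula (midpoint_formula (k + r) r))"
proof (induction r arbitrary: k)
  case 0
  obtain s where "pass vsc_delta (Find, 0, False) (tape_word k 0 P A B) = ((Find, s, False), tape_word k 0 P A B, [])"
    using pass_Find[of k 0 P A B] by auto
  from sweeps.stop[OF this, of vsc_fin "''=.''"] show ?case by simp
next
  case (Suc r)
  let ?w = "tape_word k (Suc r) P A B" and ?d = "k + Suc r"
  let ?u = "\<lambda>j. replicate (3 * k) (CHR ''x'') @ blocks (spread j 1) @ replicate (3 * r) (CHR ''x'')"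
  obtain s where f: "pass vsc_delta (Find, 0, False) ?w = ((Find, s, True), ?w, [])"
    using pass_Find[of k "Suc r" P A B] by auto
  obtain s0 b0 where m0: "pass vsc_delta (Mid 0, 0, False) ?w = ((Mid 0, s0, b0), ?w, ?u 0)"
    using pass_Mid[of 0 k r P A B] by auto
  obtain s1 b1 where m1: "pass vsc_delta (Mid 1, 0, False) ?w = ((Mid 1, s1, b1), ?w, ?u 1)"
    using pass_Mid[of 1 k r P A B] by auto
  obtain s2 b2 where m2: "pass vsc_delta (Mid 2, 0, False) ?w = ((Mid 2, s2, b2), tape_word (Suc k) r P A B, ?u 2)"
    using pass_Mid[of 2 k r P A B] by auto
  note run = sweeps_againI[OF f vsc_fin_Find sweeps_againI[OF m0 vsc_fin_Mid(1)
      sweeps_againI[OF m1 vsc_fin_Mid(2) sweeps_againI[OF m2 vsc_fin_Mid(3) Suc.IH refl] refl] refl] refl]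
  have "4 * Suc r + 1 = Suc (Suc (Suc (Suc (4 * r + 1))))" by simp
  then show ?case using run by (simp only:) (simp add: blocks_unit_exps)
qed

text \<open>Eight sweeps print the dimension, the equation b t = a and the three cluster
  constraints; the midpoint equations take the other 4 d + 1.\<close>

lemma sweeps_vsc:
  assumes "in_vars d f" "\<theta> > 0"
  shows "sweeps vsc_delta vsc_fin (4 * d + 9) (Dim, 0, False) (encode VSC (d, f, \<theta>))
    (encode ETR (3 * d + 1, vsc_formula (d, f, \<theta>)))"
proof -
  obtain a b where ab: "quotient_of \<theta> = (a, b)" by (cases "quotient_of \<theta>")
  have b: "b > 0" using quotient_of_denom_pos[OF ab] .
  have a: "a > 0" using assms(2) b quotient_of_div[OF ab] by (simp add: zero_less_divide_iff)
  \<comment> \<open>The control prints the sign before copying the numerator, which is right because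
    \<theta> > 0 makes \<open>a\<close> positive.\<close>
  have neg: "enc_int (- a) = CHR ''-'' # enc_int a" using a by (simp add: enc_int_def)
  let ?w = "tape_word 0 d (enc_poly f) (enc_int a) (enc_int b)"
  have w: "encode VSC (d, f, \<theta>) = ?w"
    by (simp add: VSC_def enc_dim_def enc_rat_def ab tape_word_def)
  have ns: "no_sep (enc_poly f)" "no_sep (enc_int a)" "no_sep (enc_int b)"
    using set_enc_poly[of f] set_enc_int[of a] set_enc_int[of b] by (auto simp: no_sep_def sep_def)
  have pad: "\<exists>s b. pass vsc_delta (k, 0, False) ?w = ((k, s, b), ?w, replicate (3 * d) (CHR ''x''))"
    if "k \<in> {Dim, PadN, PadD}" for k
    using pass_pad[OF that] .
  obtain s1 b1 where 1: "pass vsc_delta (Dim, 0, False) ?w = ((Dim, s1, b1), ?w, replicate (3 * d) (CHR ''x''))"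
    using pad[of Dim] by auto
  obtain s2 b2 where 2: "pass vsc_delta (Numer, 0, False) ?w = ((Numer, s2, b2), ?w, enc_int a)"
    using pass_number(1)[OF ns] by blast
  obtain s3 b3 where 3: "pass vsc_delta (PadN, 0, False) ?w = ((PadN, s3, b3), ?w, replicate (3 * d) (CHR ''x''))"
    using pad[of PadN] by auto
  obtain s4 b4 where 4: "pass vsc_delta (Denom, 0, False) ?w = ((Denom, s4, b4), ?w, enc_int b)"
    using pass_number(2)[OF ns] by blast
  obtain s5 b5 where 5: "pass vsc_delta (PadD, 0, False) ?w = ((PadD, s5, b5), ?w, replicate (3 * d) (CHR ''x''))"
    using pad[of PadD] by auto
  have C: "\<exists>s. pass vsc_delta (Clus j, 0, False) ?w = ((Clus j, s, False), ?w,
      replicate (3 * d) (CHR ''x'') @ ''x1;'' @ enc_poly (map (embed j) f) @ ''.'')" if "j < 3" for j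
    using pass_Clus[OF that] .
  obtain s6 where 6: "pass vsc_delta (Clus 0, 0, False) ?w = ((Clus 0, s6, False), ?w,
      replicate (3 * d) (CHR ''x'') @ ''x1;'' @ enc_poly (map (embed 0) f) @ ''.'')" using C[of 0] by auto
  obtain s7 where 7: "pass vsc_delta (Clus 1, 0, False) ?w = ((Clus 1, s7, False), ?w,
      replicate (3 * d) (CHR ''x'') @ ''x1;'' @ enc_poly (map (embed 1) f) @ ''.'')" using C[of 1] by auto
  obtain s8 where 8: "pass vsc_delta (Clus 2, 0, False) ?w = ((Clus 2, s8, False), ?w,
      replicate (3 * d) (CHR ''x'') @ ''x1;'' @ enc_poly (map (embed 2) f) @ ''.'')" using C[of 2] by auto
  have mid: "sweeps vsc_delta vsc_fin (4 * d + 1) (Find, 0, False) ?w (enc_formula (midpoint_formula d d))"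
    using sweeps_midpoint[of d 0] by simp
  have k: "blocks (const_exps d e) = replicate (3 * d) (CHR ''x'') @ ''x'' @ replicate e (CHR ''1'')" for e
    by (simp add: const_exps_def)
  show ?thesis
    using sweeps_againI[OF 1 vsc_fin.simps(1) sweeps_againI[OF 2 vsc_fin.simps(2) sweeps_againI[OF 3 vsc_fin.simps(3)
        sweeps_againI[OF 4 vsc_fin.simps(4) sweeps_againI[OF 5 vsc_fin.simps(5) sweeps_againI[OF 6 vsc_fin_Clus(1)
        sweeps_againI[OF 7 vsc_fin_Clus(2) sweeps_againI[OF 8 vsc_fin_Clus(3) mid refl] refl] refl] refl] refl] refl] refl] refl]
    by (simp add: w ETR_def enc_dim_def ab neg k cluster_def eval_nat_numeral replicate_append_same[symmetric])
qed

theorem VSC_in_ER: "VSC \<in> ER"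
proof -
  define g where "g = (\<lambda>(d, f, \<theta>). (3 * d + 1, vsc_formula (d, f, \<theta>)))"
  have "poly_time_computable VSC ETR g"
  proof (rule sweep_machine.poly_time[OF vsc_machine])
    fix x assume x: "x \<in> instances VSC"
    obtain d f \<theta> where e: "x = (d, f, \<theta>)" by (cases x)
    have "d \<le> length (encode VSC x)" by (simp add: e VSC_def enc_dim_def)
    then have "4 * d + 9 \<le> poly [:9, 4:] (length (encode VSC x))" by simp
    moreover have "sweeps vsc_delta vsc_fin (4 * d + 9) (Dim, 0, False) (encode VSC x) (encode ETR (g x))"
      using sweeps_vsc[of d f \<theta>] x by (simp add: e g_def VSC_def del: vsc_formula.simps)
    ultimately show "\<exists>m\<le>poly [:9, 4:] (length (encode VSC x)).
        sweeps vsc_delta vsc_fin m (Dim, 0, False) (encode VSC x) (encode ETR (g x))" by blast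
  qed
  moreover have "g x \<in> instances ETR \<and> (question VSC x \<longleftrightarrow> question ETR (g x))" if "x \<in> instances VSC" for x
  proof -
    obtain d f \<theta> where e: "x = (d, f, \<theta>)" by (cases x)
    have f: "in_vars d f" using that by (simp add: e VSC_def)
    show ?thesis
      using vsc_formula_in_vars[OF f, of \<theta>] vsc_formula_correct[OF f, of \<theta>]
      by (simp add: e g_def ETR_def VSC_def del: vsc_formula.simps)
  qed
  ultimately show ?thesis
    unfolding ER_def poly_time_reducible_def using wf_problem_VSC by blast
qed

section \<open>VSC is \<open>\<exists>\<real>\<close>-hard\<close>

text \<open>The variables of the current cell, those of the next cell, and the variable of the sentence whose
  tally is being read.\<close>

datatype ref = Cur nat | Nxt nat | Sel

type_synonym local_term = "int \<times> ref list"

fun ref_val :: "real \<Rightarrow> (nat \<Rightarrow> real) \<Rightarrow> (nat \<Rightarrow> real) \<Rightarrow> ref \<Rightarrow> real" where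
  "ref_val x v w (Cur a) = v a"
| "ref_val x v w (Nxt a) = w a"
| "ref_val x v w Sel = x"

definition term_val :: "real \<Rightarrow> (nat \<Rightarrow> real) \<Rightarrow> (nat \<Rightarrow> real) \<Rightarrow> local_term list \<Rightarrow> real" where
  "term_val x v w ts = (\<Sum>(c, rs)\<leftarrow>ts. of_int c * prod_list (map (ref_val x v w) rs))"

definition keep :: "nat \<Rightarrow> local_term list" where
  "keep a = [(1, [Cur a]), (- 1, [Nxt a])]"

text \<open>
  The ten variables of a cell: \<open>0\<close> is the stack; \<open>1\<close>, \<open>2\<close> and \<open>3\<close> are the sum of the complete monomials,
  the value of the current monomial, and its next power of two times the product of the variables.
  At an atom, \<open>4\<close> and \<open>5\<close> are the roots \<open>u\<close>, \<open>v\<close> of the positive and the negative part of the value of the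
  polynomial, \<open>6\<close> and \<open>7\<close> indicate \<open>u \<noteq> 0\<close> and \<open>v \<noteq> 0\<close>, and \<open>8\<close> and \<open>9\<close> are inverses.  At a connective,
  \<open>4\<close> and \<open>5\<close> are the popped truth values, \<open>8\<close> is the stack in between, and the remaining stack is the
  square of \<open>6\<close> and, by means of \<open>7\<close>, at most \<open>1\<close>.  In the prefix, \<open>0\<close> is the variable of the sentence,
  and at the separator it is \<open>z\<close>.
\<close>

definition atom_constraints :: "local_term list \<Rightarrow> local_term list list" where
  "atom_constraints t =
    [[(1, [Cur 4, Cur 4]), (- 1, [Cur 5, Cur 5]), (- 1, [Nxt 1]), (- 1, [Nxt 2])],
     [(1, [Cur 4, Cur 5])],
     [(1, [Cur 4, Cur 8]), (- 1, [Cur 6])], [(1, [Cur 4]), (- 1, [Cur 4, Cur 6])],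
     [(1, [Cur 5, Cur 9]), (- 1, [Cur 7])], [(1, [Cur 5]), (- 1, [Cur 5, Cur 7])],
     (3, [Cur 0]) # (- 1, [Nxt 0]) # t]"

text \<open>Registers 4 and 5 are idempotent, hence 0 or 1. \<open>t\<close> is minus twice the new
  truth value, so that the last equation pushes this value onto the remaining stack.\<close>

definition binop_constraints :: "local_term list \<Rightarrow> local_term list list" where
  "binop_constraints t =
    [[(3, [Nxt 0]), (- 2, [Cur 4]), (- 1, [Cur 8])],
     [(3, [Cur 8]), (- 2, [Cur 5]), (- 1, [Cur 6, Cur 6])],
     [(1, [Cur 4]), (- 1, [Cur 4, Cur 4])], [(1, [Cur 5]), (- 1, [Cur 5, Cur 5])],
     [(1, [Cur 6, Cur 6]), (1, [Cur 7, Cur 7]), (- 1, [])],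
     (3, [Cur 0]) # (- 1, [Cur 6, Cur 6]) # t]"

text \<open>\<open>m\<close> decides whether \<open>1\<close> is a tally or a digit. From the right,
  \<open>;\<close> resets registers 2 and 3 to 0 and 1, each tally multiplies register 3 by its
  variable, and the digits, least significant first, add register 3 where they are 1 and double it;
  so no coefficient ever has to be stored in the control.\<close>

definition constraints :: "bool \<Rightarrow> char \<Rightarrow> local_term list list" where
  "constraints m c =
    (if c = CHR ''#'' then [[(1, [Nxt 0]), (- 1, [])], [(1, [Cur 0, Cur 0]), (- 1, [])]]
     else if c = CHR ''1'' \<and> m then [keep 0, keep 1, keep 2, [(1, [Cur 3]), (- 1, [Sel, Nxt 3])]]
     else if c = CHR ''0'' then [keep 0, keep 1, keep 2, [(1, [Cur 3]), (- 2, [Nxt 3])]]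
     else if c = CHR ''1'' then
       [keep 0, keep 1, [(1, [Cur 2]), (- 1, [Nxt 2]), (- 1, [Nxt 3])], [(1, [Cur 3]), (- 2, [Nxt 3])]]
     else if c = CHR ''-'' then [keep 0, keep 1, [(1, [Cur 2]), (1, [Nxt 2])], keep 3]
     else if c = CHR ''x'' then [keep 0, keep 1, keep 2, keep 3]
     else if c = CHR '';'' then
       [keep 0, [(1, [Cur 1]), (- 1, [Nxt 1]), (- 1, [Nxt 2])], [(1, [Cur 2])], [(1, [Cur 3]), (- 1, [])]]
     else if c = CHR ''.'' then [keep 0, [(1, [Cur 1])], [(1, [Cur 2])], [(1, [Cur 3]), (- 1, [])]]
     else if c = CHR ''='' then atom_constraints [(- 2, []), (2, [Cur 6]), (2, [Cur 7])]
     else if c = CHR ''<'' then atom_constraints [(- 2, [Cur 7])]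
     else if c = CHR ''['' then atom_constraints [(- 2, []), (2, [Cur 6])]
     else if c = CHR ''~'' then
       [[(3, [Nxt 0]), (- 2, [Cur 4]), (- 1, [Cur 6, Cur 6])], [(1, [Cur 4]), (- 1, [Cur 4, Cur 4])],
        [(1, [Cur 6, Cur 6]), (1, [Cur 7, Cur 7]), (- 1, [])],
        [(3, [Cur 0]), (- 2, []), (2, [Cur 4]), (- 1, [Cur 6, Cur 6])]]
     else if c = CHR ''&'' then binop_constraints [(- 2, [Cur 4, Cur 5])]
     else if c = CHR ''|'' then binop_constraints [(- 2, [Cur 4]), (- 2, [Cur 5]), (2, [Cur 4, Cur 5])]
     else [])"

text \<open>A parser state \<open>(m, p)\<close>: \<open>m\<close> tells whether the exponents of a monomial are being read, and
  then \<open>p\<close> is the index of the current variable.\<close>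

fun advance :: "bool \<times> nat \<Rightarrow> char \<Rightarrow> bool \<times> nat" where
  "advance (m, p) c = (c = CHR ''x'' \<or> m \<and> c = CHR ''1'', if c = CHR ''x'' then (if m then Suc p else 0) else p)"

definition local_sat :: "(nat \<Rightarrow> real) \<Rightarrow> bool \<times> nat \<Rightarrow> char \<Rightarrow> (nat \<Rightarrow> real) \<Rightarrow> (nat \<Rightarrow> real) \<Rightarrow> bool" where
  "local_sat X s c v w \<longleftrightarrow> (\<forall>t\<in>set (constraints (fst s) c). term_val (X (snd (advance s c))) v w t = 0)"

text \<open>\<open>e\<close> stands for the cell behind the word, to which the last character refers
  as next.\<close>

fun sat :: "(nat \<Rightarrow> real) \<Rightarrow> bool \<times> nat \<Rightarrow> string \<Rightarrow> (nat \<Rightarrow> real) list \<Rightarrow> (nat \<Rightarrow> real) \<Rightarrow> bool" where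
  "sat X s [] vs e \<longleftrightarrow> vs = []"
| "sat X s (c # w) [] e \<longleftrightarrow> False"
| "sat X s (c # w) (v # vs) e \<longleftrightarrow> local_sat X s c v (hd (vs @ [e])) \<and> sat X (advance s c) w vs e"

text \<open>Of the right part the left one sees only the first cell, or \<open>e\<close> if there is
  none; that cell becomes its end cell.\<close>

lemma sat_append:
  "sat X s (w @ w') us e \<longleftrightarrow> (\<exists>vs vs'. us = vs @ vs' \<and>
     sat X s w vs (hd (vs' @ [e])) \<and> sat X (foldl advance s w) w' vs' e)"
proof (induction w arbitrary: s us)
  case (Cons c w)
  have h: "hd (vs @ vs' @ [e]) = hd (vs @ [hd (vs' @ [e])])" for vs vs'
    by (cases vs) auto
  show ?case
  proof
    assume *: "sat X s ((c # w) @ w') us e"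
    then obtain v us' where us: "us = v # us'" by (cases us) auto
    then obtain vs vs' where "us' = vs @ vs'"
      "sat X (advance s c) w vs (hd (vs' @ [e]))" "sat X (foldl advance (advance s c) w) w' vs' e"
      using * Cons.IH by auto
    then show "\<exists>vs vs'. us = vs @ vs' \<and> sat X s (c # w) vs (hd (vs' @ [e])) \<and>
        sat X (foldl advance s (c # w)) w' vs' e"
      using * us by (intro exI[of _ "v # vs"] exI[of _ vs']) (simp add: h)
  next
    assume "\<exists>vs vs'. us = vs @ vs' \<and> sat X s (c # w) vs (hd (vs' @ [e])) \<and>
        sat X (foldl advance s (c # w)) w' vs' e"
    then obtain us1 vs' where *: "us = us1 @ vs'" "sat X s (c # w) us1 (hd (vs' @ [e]))"
      "sat X (foldl advance s (c # w)) w' vs' e" by blast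
    then obtain v vs where us1: "us1 = v # vs" by (cases us1) auto
    have "sat X (advance s c) (w @ w') (vs @ vs') e"
      unfolding Cons.IH using * us1 by (intro exI[of _ vs] exI[of _ vs']) simp
    then show "sat X s ((c # w) @ w') us e"
      using * us1 by (simp add: h)
  qed
qed simp

section \<open>The constraints of a single cell\<close>

lemma local_sat_simps:
  "local_sat X s (CHR ''#'') v w \<longleftrightarrow> w 0 = 1 \<and> v 0 * v 0 = 1"
  "local_sat X (True, p) (CHR ''1'') v w \<longleftrightarrow> v 0 = w 0 \<and> v 1 = w 1 \<and> v 2 = w 2 \<and> v 3 = X p * w 3"
  "local_sat X s (CHR ''0'') v w \<longleftrightarrow> v 0 = w 0 \<and> v 1 = w 1 \<and> v 2 = w 2 \<and> v 3 = 2 * w 3"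
  "local_sat X (False, p) (CHR ''1'') v w \<longleftrightarrow> v 0 = w 0 \<and> v 1 = w 1 \<and> v 2 = w 2 + w 3 \<and> v 3 = 2 * w 3"
  "local_sat X s (CHR ''-'') v w \<longleftrightarrow> v 0 = w 0 \<and> v 1 = w 1 \<and> v 2 = - w 2 \<and> v 3 = w 3"
  "local_sat X s (CHR ''x'') v w \<longleftrightarrow> v 0 = w 0 \<and> v 1 = w 1 \<and> v 2 = w 2 \<and> v 3 = w 3"
  "local_sat X s (CHR '';'') v w \<longleftrightarrow> v 0 = w 0 \<and> v 1 = w 1 + w 2 \<and> v 2 = 0 \<and> v 3 = 1"
  "local_sat X s (CHR ''.'') v w \<longleftrightarrow> v 0 = w 0 \<and> v 1 = 0 \<and> v 2 = 0 \<and> v 3 = 1"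
  by (cases s; auto simp: local_sat_def constraints_def keep_def term_val_def)+

lemma local_sat_not:
  "local_sat X s (CHR ''~'') v w \<longleftrightarrow> 3 * w 0 = 2 * v 4 + v 6 * v 6 \<and> v 4 = v 4 * v 4 \<and>
     v 6 * v 6 + v 7 * v 7 = 1 \<and> 3 * v 0 = 2 * (1 - v 4) + v 6 * v 6"
  by (auto simp: local_sat_def constraints_def term_val_def)

lemma binop_constraints_iff:
  "(\<forall>t\<in>set (binop_constraints ts). term_val x v w t = 0) \<longleftrightarrow>
     3 * w 0 = 2 * v 4 + v 8 \<and> 3 * v 8 = 2 * v 5 + v 6 * v 6 \<and> v 4 = v 4 * v 4 \<and> v 5 = v 5 * v 5 \<and>
     v 6 * v 6 + v 7 * v 7 = 1 \<and> 3 * v 0 = v 6 * v 6 - term_val x v w ts"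
  by (auto simp: binop_constraints_def term_val_def)

lemma local_sat_binop:
  "local_sat X s (CHR ''&'') v w \<longleftrightarrow> 3 * w 0 = 2 * v 4 + v 8 \<and> 3 * v 8 = 2 * v 5 + v 6 * v 6 \<and>
     v 4 = v 4 * v 4 \<and> v 5 = v 5 * v 5 \<and> v 6 * v 6 + v 7 * v 7 = 1 \<and> 3 * v 0 = v 6 * v 6 + 2 * (v 4 * v 5)"
  "local_sat X s (CHR ''|'') v w \<longleftrightarrow> 3 * w 0 = 2 * v 4 + v 8 \<and> 3 * v 8 = 2 * v 5 + v 6 * v 6 \<and>
     v 4 = v 4 * v 4 \<and> v 5 = v 5 * v 5 \<and> v 6 * v 6 + v 7 * v 7 = 1 \<and>
     3 * v 0 = v 6 * v 6 + 2 * (v 4 + v 5 - v 4 * v 5)"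
  unfolding local_sat_def constraints_def
  by (simp_all add: binop_constraints_iff) (simp_all add: term_val_def algebra_simps)

lemma atom_constraints_iff:
  "(\<forall>t\<in>set (atom_constraints ts). term_val x v w t = 0) \<longleftrightarrow>
     v 4 * v 4 - v 5 * v 5 = w 1 + w 2 \<and> v 4 * v 5 = 0 \<and> v 4 * v 8 = v 6 \<and> v 4 = v 4 * v 6 \<and>
     v 5 * v 9 = v 7 \<and> v 5 = v 5 * v 7 \<and> 3 * v 0 = w 0 - term_val x v w ts"
  by (auto simp: atom_constraints_def term_val_def)

text \<open>Since u v = 0, the equation u^2 - v^2 = g makes u^2 and v^2 the positive and negative
  parts of g. A flag b with b = u i for some i, and u = u b, is 0 if u = 0 and 1 otherwise; so the
  flags give the sign of g exactly.\<close>

lemma local_sat_atom: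
  assumes "local_sat X s c v w" "c \<in> {CHR ''='', CHR ''<'', CHR ''[''}"
  shows "3 * v 0 = 2 * of_bool (if c = CHR ''='' then w 1 + w 2 = 0 else if c = CHR ''<'' then w 1 + w 2 < 0
      else w 1 + w 2 \<le> 0) + w 0"
proof -
  obtain ts where ts: "constraints (fst s) c = atom_constraints ts"
    and t: "term_val (X (snd (advance s c))) v w ts = (if c = CHR ''='' then 2 * v 6 + 2 * v 7 - 2
      else if c = CHR ''<'' then - 2 * v 7 else 2 * v 6 - 2)"
    using assms(2) by (auto simp: constraints_def term_val_def)
  have *: "v 4 * v 4 - v 5 * v 5 = w 1 + w 2" "v 4 * v 5 = 0" "v 4 * v 8 = v 6" "v 4 = v 4 * v 6"
     "v 5 * v 9 = v 7" "v 5 = v 5 * v 7" "3 * v 0 = w 0 - term_val (X (snd (advance s c))) v w ts"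
    using assms(1) unfolding local_sat_def ts atom_constraints_iff by auto
  have "v 6 = of_bool (w 1 + w 2 > 0) \<and> v 7 = of_bool (w 1 + w 2 < 0)"
  proof (cases "v 4 = 0")
    case True
    then have 6: "v 6 = 0" and g: "w 1 + w 2 = - (v 5 * v 5)" using *(1,3) by auto
    show ?thesis
    proof (cases "v 5 = 0")
      case True
      then show ?thesis using 6 g *(5) by simp
    next
      case False
      then have "v 7 = 1" "v 5 * v 5 > 0" using *(6) by (auto simp: zero_less_mult_iff)
      then show ?thesis using 6 g by simp
    qed
  next
    case False
    then have "v 5 = 0" "v 6 = 1" "v 4 * v 4 > 0" using *(2,4) by (auto simp: zero_less_mult_iff)
    moreover from this have "v 7 = 0" "w 1 + w 2 = v 4 * v 4" using *(1,5) by auto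
    ultimately show ?thesis by simp
  qed
  then show ?thesis using *(7) t assms(2) by (auto simp: of_bool_def split: if_splits)
qed

lemma local_sat_atom_exists:
  assumes "c \<in> {CHR ''='', CHR ''<'', CHR ''[''}"
  shows "\<exists>v. local_sat X s c v w"
proof -
  define g where "g = w 1 + w 2"
  define u where "u = sqrt (max g 0)"
  define z where "z = sqrt (max (- g) 0)"
  have uz: "u * u - z * z = g" "u * z = 0"
    by (auto simp: u_def z_def max_def real_sqrt_mult[symmetric])
  \<comment> \<open>The three atoms differ only in how the pushed value depends on the two flags;
    \<open>f\<close> abstracts from this.\<close>
  have "\<exists>v. local_sat X s c v w" if "constraints (fst s) c = atom_constraints ts"
    "\<And>v. term_val (X (snd (advance s c))) v w ts = f (v 6) (v 7)" for ts and f :: "real \<Rightarrow> real \<Rightarrow> real"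
    unfolding local_sat_def that(1) atom_constraints_iff that(2) g_def[symmetric] using uz
    by (intro exI[of _ "\<lambda>i. [(w 0 - f (of_bool (u \<noteq> 0)) (of_bool (z \<noteq> 0))) / 3, 0, 0, 0, u, z,
       of_bool (u \<noteq> 0), of_bool (z \<noteq> 0), inverse u, inverse z] ! i"]) auto
  note * = this
  from assms show ?thesis
  proof (elim insertE emptyE)
    assume "c = CHR ''=''"
    then show ?thesis by (intro *[of _ "\<lambda>a b. 2 * a + 2 * b - 2"]) (auto simp: constraints_def term_val_def)
  next
    assume "c = CHR ''<''"
    then show ?thesis by (intro *[of _ "\<lambda>a b. - 2 * b"]) (auto simp: constraints_def term_val_def)
  next
    assume "c = CHR ''[''"
    then show ?thesis by (intro *[of _ "\<lambda>a b. 2 * a - 2"]) (auto simp: constraints_def term_val_def)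
  qed
qed

section \<open>Evaluation of an encoded polynomial by the registers\<close>

lemma foldl_advance_coef:
  "set w \<subseteq> {CHR ''-'', CHR ''0'', CHR ''1''} \<Longrightarrow> foldl advance (False, p) w = (False, p)"
  by (induction w) auto

lemma foldl_advance_tally: "foldl advance (True, p) (replicate e (CHR ''1'')) = (True, p)"
  by (induction e) auto

lemma foldl_advance_poly: "\<exists>p'. foldl advance (False, p) (enc_poly f) = (False, p')"
proof (induction f arbitrary: p)
  case (Cons m f)
  obtain c es where m: "m = (c, es)" by (cases m)
  obtain m' p' where "foldl advance (False, p) (blocks es) = (m', p')" by fastforce
  then show ?case using Cons.IH[of p'] by (simp add: m foldl_advance_coef[OF set_enc_int])
qed simp

text \<open>Split off the last digit: its cell adds the weight \<open>w 3\<close> if the digit is 1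
  and doubles it for the remaining digits, which represent k div 2.\<close>

lemma sat_binary:
  "sat X (False, p) (binary k) vs w \<Longrightarrow>
   hd (vs @ [w]) 0 = w 0 \<and> hd (vs @ [w]) 1 = w 1 \<and> hd (vs @ [w]) 2 = w 2 + real k * w 3"
proof (induction k arbitrary: vs w rule: less_induct)
  case (less k)
  show ?case
  proof (cases "k < 2")
    case True
    then obtain v where "vs = [v]" "local_sat X (False, p) (digit k) v w"
      using less.prems by (cases vs) (auto simp: binary.simps[of k])
    then show ?thesis using True by (auto simp: less_2_cases_iff digit_def local_sat_simps)
  next
    case False
    then obtain us us' where vs: "vs = us @ us'" and 1: "sat X (False, p) (binary (k div 2)) us (hd (us' @ [w]))"
      and "sat X (False, p) [digit (k mod 2)] us' w"
      using less.prems by (auto simp: binary.simps[of k] sat_append foldl_advance_coef set_binary[THEN subset_trans])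
    then obtain v where v: "us' = [v]" "local_sat X (False, p) (digit (k mod 2)) v w"
      by (cases us') auto
    have "real k = 2 * real (k div 2) + real (k mod 2)"
      by (metis mult_div_mod_eq of_nat_add of_nat_mult of_nat_numeral)
    moreover have "hd (vs @ [w]) = hd (us @ [v])" using vs v(1) by (cases us) auto
    moreover have "v 0 = w 0 \<and> v 1 = w 1 \<and> v 2 = w 2 + real (k mod 2) * w 3 \<and> v 3 = 2 * w 3"
      using v(2) by (cases "k mod 2 = 0") (auto simp: digit_def local_sat_simps)
    ultimately show ?thesis using less.IH[OF _ 1] False v(1) by (simp add: algebra_simps)
  qed
qed

lemma sat_enc_int:
  assumes "sat X (False, p) (enc_int c) vs w" "w 2 = 0"
  shows "hd (vs @ [w]) 0 = w 0 \<and> hd (vs @ [w]) 1 = w 1 \<and> hd (vs @ [w]) 2 = of_int c * w 3"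
proof (cases "c < 0")
  case True
  then obtain v us where "vs = v # us" "local_sat X (False, p) (CHR ''-'') v (hd (us @ [w]))"
    "sat X (False, p) (binary (nat \<bar>c\<bar>)) us w"
    using assms(1) by (cases vs) (auto simp: enc_int_def)
  then show ?thesis using sat_binary[of X p "nat \<bar>c\<bar>" us w] assms(2) True by (simp add: local_sat_simps)
next
  case False
  then show ?thesis using sat_binary[of X p "nat \<bar>c\<bar>" vs w] assms by (simp add: enc_int_def)
qed

lemma sat_tally:
  "sat X (True, p) (replicate e (CHR ''1'')) vs w \<Longrightarrow>
   hd (vs @ [w]) 0 = w 0 \<and> hd (vs @ [w]) 1 = w 1 \<and> hd (vs @ [w]) 2 = w 2 \<and> hd (vs @ [w]) 3 = X p ^ e * w 3"
proof (induction e arbitrary: vs)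
  case (Suc e)
  then show ?case by (cases vs) (auto simp: local_sat_simps)
qed simp

text \<open>If \<open>m\<close> holds, the word continues a monomial and its first block belongs to
  the variable after \<open>p\<close>; otherwise the numbering starts at 0.\<close>

lemma sat_blocks:
  "sat X (m, p) (blocks es) vs w \<Longrightarrow>
   hd (vs @ [w]) 0 = w 0 \<and> hd (vs @ [w]) 1 = w 1 \<and> hd (vs @ [w]) 2 = w 2 \<and>
   hd (vs @ [w]) 3 = (\<Prod>i<length es. X ((if m then Suc p else 0) + i) ^ (es ! i)) * w 3"
proof (induction es arbitrary: m p vs)
  case (Cons e es)
  define k where "k = (if m then Suc p else 0)"
  obtain v us us' where vs: "vs = v # us @ us'"
    and v: "local_sat X (m, p) (CHR ''x'') v (hd (us @ us' @ [w]))"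
    and 1: "sat X (True, k) (replicate e (CHR ''1'')) us (hd (us' @ [w]))"
    and 2: "sat X (True, k) (blocks es) us' w"
    using Cons.prems by (cases vs) (auto simp: sat_append foldl_advance_tally k_def)
  have h: "hd (us @ us' @ [w]) = hd (us @ [hd (us' @ [w])])" by (cases us) auto
  have "(\<Prod>i<length (e # es). X (k + i) ^ ((e # es) ! i)) = X k ^ e * (\<Prod>i<length es. X (Suc k + i) ^ (es ! i))"
    by (simp add: prod.lessThan_Suc_shift del: prod.lessThan_Suc)
  then show ?case
    using v sat_tally[OF 1] Cons.IH[OF 2] unfolding k_def[symmetric] vs h
    by (simp add: local_sat_simps h)
qed simp

text \<open>A monomial moves from register 2 to register 1 at the \<open>;\<close> to its left,
  which the leftmost monomial lacks; hence the sum of both registers.\<close>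

lemma sat_poly:
  "in_vars n f \<Longrightarrow> sat X (False, p) (enc_poly f @ ''.'') vs w \<Longrightarrow>
   hd (vs @ [w]) 0 = w 0 \<and> hd (vs @ [w]) 1 + hd (vs @ [w]) 2 = eval f (map X [0..<n])"
proof (induction f arbitrary: p vs)
  case Nil
  then show ?case by (cases vs) (auto simp: local_sat_simps)
next
  case (Cons m f)
  obtain c es where m: "m = (c, es)" by (cases m)
  have es: "length es = n" using Cons.prems(1) m by (simp add: in_vars_def)
  obtain m' p' where a: "foldl advance (False, p) (blocks es) = (m', p')" by fastforce
  obtain us1 us2 v us where vs: "vs = us1 @ us2 @ v # us"
    and 1: "sat X (False, p) (enc_int c) us1 (hd (us2 @ [v]))"
    and 2: "sat X (False, p) (blocks es) us2 v"
    and 3: "local_sat X (m', p') (CHR '';'') v (hd (us @ [w]))"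
    and 4: "sat X (False, p') (enc_poly f @ ''.'') us w"
  proof -
    from Cons.prems(2) obtain us1 us' where u: "vs = us1 @ us'"
      "sat X (False, p) (enc_int c) us1 (hd (us' @ [w]))"
      "sat X (False, p) (blocks es @ '';'' @ enc_poly f @ ''.'') us' w"
      by (auto simp: m sat_append[of _ _ "enc_int c"] foldl_advance_coef[OF set_enc_int])
    from u(3) obtain us2 us'' where u': "us' = us2 @ us''"
      "sat X (False, p) (blocks es) us2 (hd (us'' @ [w]))" "sat X (m', p') ('';'' @ enc_poly f @ ''.'') us'' w"
      unfolding sat_append[of _ _ "blocks es"] a by blast
    then obtain v us where u'': "us'' = v # us" by (cases us'') auto
    show thesis
      by (rule that[of us1 us2 v us]) (use u u' u'' in \<open>auto simp: hd_append\<close>)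
  qed
  have "in_vars n f" using Cons.prems(1) by (simp add: in_vars_def)
  note IH = Cons.IH[OF this 4]
  have h: "hd (vs @ [w]) = hd (us1 @ [hd (us2 @ [v])])" by (simp add: vs hd_append)
  have "(\<Prod>i<length es. X i ^ (es ! i)) = (\<Prod>i<length es. map X [0..<n] ! i ^ (es ! i))"
    by (rule prod.cong) (auto simp: es)
  then show ?case
    using IH 3 sat_blocks[OF 2] sat_enc_int[OF 1] unfolding h by (simp add: local_sat_simps m)
qed

text \<open>On these characters the constraints assign registers 0 to 3 of a cell in terms of the
  next cell, so they can be solved from right to left.\<close>

lemma sat_poly_exists:
  "set w \<subseteq> {CHR ''-'', CHR ''0'', CHR ''1'', CHR ''x'', CHR '';'', CHR ''.''} \<Longrightarrow> \<exists>vs. sat X s w vs e"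
proof (induction w arbitrary: s)
  case Nil
  show ?case by simp
next
  case (Cons c w)
  have "set w \<subseteq> {CHR ''-'', CHR ''0'', CHR ''1'', CHR ''x'', CHR '';'', CHR ''.''}" using Cons.prems by simp
  from Cons.IH[OF this] obtain vs where vs: "sat X (advance s c) w vs e" by blast
  have ex: "\<exists>v :: nat \<Rightarrow> real. v 0 = a \<and> v 1 = b \<and> v 2 = g \<and> v 3 = h" for a b g h :: real
    by (rule exI[of _ "\<lambda>i. [a, b, g, h] ! i"]) (simp add: numeral_3_eq_3)
  obtain m p where s: "s = (m, p)" by (cases s)
  have "c \<in> {CHR ''-'', CHR ''0'', CHR ''1'', CHR ''x'', CHR '';'', CHR ''.''}" using Cons.prems by simp
  then have "\<exists>v. local_sat X s c v (hd (vs @ [e]))"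
  proof (elim insertE emptyE)
    assume c: "c = CHR ''1''"
    show ?thesis
    proof (cases m)
      case True
      then have m: "m = True" by simp
      show ?thesis unfolding s c m local_sat_simps by (rule ex)
    next
      case False
      then have m: "m = False" by simp
      show ?thesis unfolding s c m local_sat_simps by (rule ex)
    qed
  qed (simp only: local_sat_simps, rule ex)+
  then obtain v where "local_sat X s c v (hd (vs @ [e]))" by blast
  then have "sat X s (c # w) (v # vs) e" using vs by simp
  then show ?case by blast
qed

section \<open>Evaluation of formulas on the stack\<close>

lemma foldl_advance_formula: "\<exists>p'. foldl advance (False, p) (enc_formula \<phi>) = (False, p')"
proof (induction \<phi> arbitrary: p)
  case (Zero f)
  obtain p' where "foldl advance (False, p) (enc_poly f) = (False, p')" using foldl_advance_poly by blast
  then show ?case by simp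
next
  case (Negative f)
  obtain p' where "foldl advance (False, p) (enc_poly f) = (False, p')" using foldl_advance_poly by blast
  then show ?case by simp
next
  case (Nonpositive f)
  obtain p' where "foldl advance (False, p) (enc_poly f) = (False, p')" using foldl_advance_poly by blast
  then show ?case by simp
next
  case (Conj \<phi> \<psi>)
  obtain p' where "foldl advance (False, p) (enc_formula \<phi>) = (False, p')" using Conj.IH(1) by blast
  then show ?case using Conj.IH(2)[of p'] by simp
next
  case (Disj \<phi> \<psi>)
  obtain p' where "foldl advance (False, p) (enc_formula \<phi>) = (False, p')" using Disj.IH(1) by blast
  then show ?case using Disj.IH(2)[of p'] by simp
qed simp

text \<open>The bounds travel with the digit because decoding needs the remaining stack to lie in
  [0, 1].\<close>

definition encodes :: "(nat \<Rightarrow> real) \<Rightarrow> bool \<Rightarrow> (nat \<Rightarrow> real) \<Rightarrow> bool" where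
  "encodes v t w \<longleftrightarrow> 3 * v 0 = 2 * of_bool t + w 0 \<and> 0 \<le> v 0 \<and> v 0 \<le> 1"

text \<open>Another digit would change 2 a by 2, but r and e differ by at most 1.\<close>

lemma unit_interval_unique:
  fixes a r e :: real
  assumes "a = a * a" "0 \<le> r" "r \<le> 1" "0 \<le> e" "e \<le> 1" "2 * a + r = 2 * of_bool t + e"
  shows "a = of_bool t \<and> r = e"
proof -
  have "a = 0 \<or> a = 1" using assms(1) by auto
  then show ?thesis using assms(2-) by (cases t) auto
qed

lemma encodes_digit:
  assumes "encodes v t w" "0 \<le> w 0" "w 0 \<le> 1" "3 * v 0 = 2 * a + r" "a = a * a" "0 \<le> r" "r \<le> 1"
  shows "a = of_bool t \<and> r = w 0"
  using unit_interval_unique[of a r "w 0" t] assms by (simp add: encodes_def)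

lemma encodesI:
  "0 \<le> w 0 \<Longrightarrow> w 0 \<le> 1 \<Longrightarrow> 3 * v 0 = 2 * of_bool t + w 0 \<Longrightarrow> encodes v t w"
  by (cases t) (auto simp: encodes_def)

lemma sat_atom:
  assumes "in_vars n f" "c \<in> {CHR ''='', CHR ''<'', CHR ''[''}" "0 \<le> w 0" "w 0 \<le> 1"
    and "sat X (False, p) (c # enc_poly f @ ''.'') vs w"
  shows "encodes (hd (vs @ [w])) (if c = CHR ''='' then eval f (map X [0..<n]) = 0
    else if c = CHR ''<'' then eval f (map X [0..<n]) < 0 else eval f (map X [0..<n]) \<le> 0) w"
proof -
  obtain v us where vs: "vs = v # us" using assms(5) by (cases vs) auto
  have "local_sat X (False, p) c v (hd (us @ [w]))" "sat X (False, p) (enc_poly f @ ''.'') us w"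
    using assms(2,5) by (auto simp: vs)
  then show ?thesis
    using local_sat_atom[OF _ assms(2)] sat_poly[OF assms(1)] assms(3,4) unfolding vs
    by (intro encodesI) auto
qed

lemma sat_atom_exists:
  assumes "c \<in> {CHR ''='', CHR ''<'', CHR ''[''}"
  shows "\<exists>vs. sat X (False, p) (c # enc_poly f @ ''.'') vs w"
proof -
  have "\<exists>us. sat X (advance (False, p) c) (enc_poly f @ ''.'') us w"
    using set_enc_poly[of f] by (intro sat_poly_exists) auto
  then obtain us where us: "sat X (advance (False, p) c) (enc_poly f @ ''.'') us w" by blast
  obtain v where "local_sat X (False, p) c v (hd (us @ [w]))"
    using local_sat_atom_exists[OF assms] by blast
  with us have "sat X (False, p) (c # enc_poly f @ ''.'') (v # us) w" by simp
  then show ?thesis by blast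
qed

text \<open>Evaluation from the right leaves the left operand \<open>a\<close> on top. Popping it
  requires register 8 in [0, 1], which the equations of this cell guarantee; register 8 is then the
  stack below, and the second pop works alike.\<close>

lemma local_sat_binop_unique:
  assumes "3 * u 0 = 2 * v 4 + v 8 \<and> 3 * v 8 = 2 * v 5 + v 6 * v 6 \<and>
     v 4 = v 4 * v 4 \<and> v 5 = v 5 * v 5 \<and> v 6 * v 6 + v 7 * v 7 = 1 \<and> 3 * v 0 = v 6 * v 6 + 2 * f (v 4) (v 5)"
    and "encodes u a u'" "encodes u' b w" "0 \<le> w 0" "w 0 \<le> 1"
    and "f (of_bool a) (of_bool b) = of_bool c"
  shows "encodes v c w"
proof -
  have r: "0 \<le> v 6 * v 6" "0 \<le> v 7 * v 7" by simp_all
  then have r1: "v 6 * v 6 \<le> 1" using assms(1) by linarith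
  have "v 5 = 0 \<or> v 5 = 1" and 3: "3 * v 8 = 2 * v 5 + v 6 * v 6" using assms(1) by auto
  then have "0 \<le> v 5" "v 5 \<le> 1" by auto
  then have 8: "0 \<le> v 8" "v 8 \<le> 1" using 3 r r1 by linarith+
  have u': "0 \<le> u' 0" "u' 0 \<le> 1" using assms(3) by (auto simp: encodes_def)
  have 1: "v 4 = of_bool a \<and> v 8 = u' 0"
    by (rule encodes_digit[OF assms(2) u']) (use assms(1) 8 in auto)
  have 2: "v 5 = of_bool b \<and> v 6 * v 6 = w 0"
    by (rule encodes_digit[OF assms(3-5)]) (use assms(1) r r1 1 in auto)
  show ?thesis using assms(1,4-6) 1 2 by (intro encodesI) auto
qed

text \<open>Every solution pushes the exact truth value, also a false one, which is what negation
  needs. In the binary cases the right subformula comes first: its result is the stack on which the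
  left one is evaluated.\<close>

lemma sat_formula:
  "formula_in_vars n \<phi> \<Longrightarrow> 0 \<le> w 0 \<Longrightarrow> w 0 \<le> 1 \<Longrightarrow> sat X (False, p) (enc_formula \<phi>) vs w \<Longrightarrow>
   encodes (hd (vs @ [w])) (holds \<phi> (map X [0..<n])) w"
proof (induction \<phi> arbitrary: p vs w)
  case (Zero f)
  then show ?case using sat_atom[of n f "CHR ''=''" w X p vs] by simp
next
  case (Negative f)
  then show ?case using sat_atom[of n f "CHR ''<''" w X p vs] by simp
next
  case (Nonpositive f)
  then show ?case using sat_atom[of n f "CHR ''[''" w X p vs] by simp
next
  case (Neg \<phi>)
  obtain v us where vs: "vs = v # us" using Neg.prems(4) by (cases vs) auto
  have l: "local_sat X (False, p) (CHR ''~'') v (hd (us @ [w]))" and "sat X (False, p) (enc_formula \<phi>) us w"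
    using Neg.prems(4) by (auto simp: vs)
  then have e: "encodes (hd (us @ [w])) (holds \<phi> (map X [0..<n])) w" using Neg.IH Neg.prems by simp
  have r: "0 \<le> v 6 * v 6" "0 \<le> v 7 * v 7" by simp_all
  then have "v 6 * v 6 \<le> 1" using l unfolding local_sat_not by linarith
  then have "v 4 = of_bool (holds \<phi> (map X [0..<n])) \<and> v 6 * v 6 = w 0"
    using encodes_digit[OF e Neg.prems(2,3)] l r unfolding local_sat_not by blast
  then show ?case using l Neg.prems unfolding local_sat_not vs
    by (intro encodesI) (auto simp: of_bool_def)
next
  case (Conj \<phi> \<psi>)
  obtain p' where p': "foldl advance (False, p) (enc_formula \<phi>) = (False, p')" using foldl_advance_formula by blast
  obtain v us where vs: "vs = v # us" using Conj.prems(4) by (cases vs) auto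
  obtain us1 us2 where us: "us = us1 @ us2"
    and 1: "sat X (False, p) (enc_formula \<phi>) us1 (hd (us2 @ [w]))" and 2: "sat X (False, p') (enc_formula \<psi>) us2 w"
    and l: "local_sat X (False, p) (CHR ''&'') v (hd (us @ [w]))"
    using Conj.prems(4) by (auto simp: vs sat_append p')
  have b: "encodes (hd (us2 @ [w])) (holds \<psi> (map X [0..<n])) w" using Conj.IH(2)[OF _ _ _ 2] Conj.prems by simp
  then have i: "0 \<le> hd (us2 @ [w]) 0" "hd (us2 @ [w]) 0 \<le> 1" by (simp_all add: encodes_def)
  have "hd (us @ [w]) = hd (us1 @ [hd (us2 @ [w])])" by (cases us1) (simp_all add: us)
  then have a: "encodes (hd (us @ [w])) (holds \<phi> (map X [0..<n])) (hd (us2 @ [w]))"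
    using Conj.IH(1)[OF _ i 1] Conj.prems by simp
  show ?case unfolding vs
    using local_sat_binop_unique[where v = v and f = "\<lambda>a b. a * b", OF l[unfolded local_sat_binop] a b Conj.prems(2,3)] by simp
next
  case (Disj \<phi> \<psi>)
  obtain p' where p': "foldl advance (False, p) (enc_formula \<phi>) = (False, p')" using foldl_advance_formula by blast
  obtain v us where vs: "vs = v # us" using Disj.prems(4) by (cases vs) auto
  obtain us1 us2 where us: "us = us1 @ us2"
    and 1: "sat X (False, p) (enc_formula \<phi>) us1 (hd (us2 @ [w]))" and 2: "sat X (False, p') (enc_formula \<psi>) us2 w"
    and l: "local_sat X (False, p) (CHR ''|'') v (hd (us @ [w]))"
    using Disj.prems(4) by (auto simp: vs sat_append p')
  have b: "encodes (hd (us2 @ [w])) (holds \<psi> (map X [0..<n])) w" using Disj.IH(2)[OF _ _ _ 2] Disj.prems by simp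
  then have i: "0 \<le> hd (us2 @ [w]) 0" "hd (us2 @ [w]) 0 \<le> 1" by (simp_all add: encodes_def)
  have "hd (us @ [w]) = hd (us1 @ [hd (us2 @ [w])])" by (cases us1) (simp_all add: us)
  then have a: "encodes (hd (us @ [w])) (holds \<phi> (map X [0..<n])) (hd (us2 @ [w]))"
    using Disj.IH(1)[OF _ i 1] Disj.prems by simp
  show ?case unfolding vs
    using local_sat_binop_unique[where v = v and f = "\<lambda>a b. a + b - a * b", OF l[unfolded local_sat_binop] a b Disj.prems(2,3)] by (simp add: of_bool_def)
qed

lemma local_sat_binop_exists:
  assumes "encodes u a u'" "encodes u' b w" "0 \<le> w 0" "w 0 \<le> 1"
  shows "\<exists>v :: nat \<Rightarrow> real. 3 * u 0 = 2 * v 4 + v 8 \<and> 3 * v 8 = 2 * v 5 + v 6 * v 6 \<and>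
     v 4 = v 4 * v 4 \<and> v 5 = v 5 * v 5 \<and> v 6 * v 6 + v 7 * v 7 = 1 \<and> 3 * v 0 = v 6 * v 6 + 2 * f (v 4) (v 5)"
  using assms
  by (intro exI[of _ "\<lambda>i. [(w 0 + 2 * f (of_bool a) (of_bool b)) / 3, 0, 0, 0, of_bool a, of_bool b,
      sqrt (w 0), sqrt (1 - w 0), u' 0] ! i"]) (auto simp: encodes_def)

text \<open>The constraints compute a truth value without demanding it, so they are solvable even
  for a false formula. \<open>sat_formula\<close> tells which digits the solution for a subformula
  offers to the connective.\<close>

lemma sat_formula_exists:
  "formula_in_vars n \<phi> \<Longrightarrow> 0 \<le> w 0 \<Longrightarrow> w 0 \<le> 1 \<Longrightarrow> \<exists>vs. sat X (False, p) (enc_formula \<phi>) vs w"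
proof (induction \<phi> arbitrary: p w)
  case (Zero f)
  show ?case using sat_atom_exists[of "CHR ''=''"] by simp
next
  case (Negative f)
  show ?case using sat_atom_exists[of "CHR ''<''"] by simp
next
  case (Nonpositive f)
  show ?case using sat_atom_exists[of "CHR ''[''"] by simp
next
  case (Neg \<phi>)
  obtain us where us: "sat X (False, p) (enc_formula \<phi>) us w" using Neg.IH[of w p] Neg.prems by auto
  have e: "encodes (hd (us @ [w])) (holds \<phi> (map X [0..<n])) w" using sat_formula[OF _ _ _ us] Neg.prems by simp
  let ?t = "of_bool (holds \<phi> (map X [0..<n])) :: real"
  have "local_sat X (False, p) (CHR ''~'')
     (\<lambda>i. [(2 * (1 - ?t) + w 0) / 3, 0, 0, 0, ?t, 0, sqrt (w 0), sqrt (1 - w 0)] ! i) (hd (us @ [w]))"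
    using e Neg.prems unfolding local_sat_not by (auto simp: encodes_def)
  with us show ?case by (intro exI[of _ "_ # us"]) auto
next
  case (Conj \<phi> \<psi>)
  obtain p' where p': "foldl advance (False, p) (enc_formula \<phi>) = (False, p')" using foldl_advance_formula by blast
  obtain us2 where 2: "sat X (False, p') (enc_formula \<psi>) us2 w" using Conj.IH(2)[of w p'] Conj.prems by auto
  have b: "encodes (hd (us2 @ [w])) (holds \<psi> (map X [0..<n])) w" using sat_formula[OF _ _ _ 2] Conj.prems by simp
  then have i: "0 \<le> hd (us2 @ [w]) 0" "hd (us2 @ [w]) 0 \<le> 1" by (simp_all add: encodes_def)
  obtain us1 where 1: "sat X (False, p) (enc_formula \<phi>) us1 (hd (us2 @ [w]))"
    using Conj.IH(1)[of "hd (us2 @ [w])" p] Conj.prems i by auto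
  have a: "encodes (hd (us1 @ [hd (us2 @ [w])])) (holds \<phi> (map X [0..<n])) (hd (us2 @ [w]))"
    using sat_formula[OF _ i 1, of n] Conj.prems by simp
  obtain v where "local_sat X (False, p) (CHR ''&'') v (hd (us1 @ [hd (us2 @ [w])]))"
    using local_sat_binop_exists[OF a b Conj.prems(2,3), of "\<lambda>a b. a * b"] unfolding local_sat_binop by blast
  moreover have "sat X (False, p) (enc_formula \<phi> @ enc_formula \<psi>) (us1 @ us2) w"
    using 1 2 by (auto simp: sat_append p')
  moreover have "hd ((us1 @ us2) @ [w]) = hd (us1 @ [hd (us2 @ [w])])" by (cases us1) simp_all
  ultimately have "sat X (False, p) (enc_formula (Conj \<phi> \<psi>)) (v # us1 @ us2) w"
    by simp
  then show ?case by blast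
next
  case (Disj \<phi> \<psi>)
  obtain p' where p': "foldl advance (False, p) (enc_formula \<phi>) = (False, p')" using foldl_advance_formula by blast
  obtain us2 where 2: "sat X (False, p') (enc_formula \<psi>) us2 w" using Disj.IH(2)[of w p'] Disj.prems by auto
  have b: "encodes (hd (us2 @ [w])) (holds \<psi> (map X [0..<n])) w" using sat_formula[OF _ _ _ 2] Disj.prems by simp
  then have i: "0 \<le> hd (us2 @ [w]) 0" "hd (us2 @ [w]) 0 \<le> 1" by (simp_all add: encodes_def)
  obtain us1 where 1: "sat X (False, p) (enc_formula \<phi>) us1 (hd (us2 @ [w]))"
    using Disj.IH(1)[of "hd (us2 @ [w])" p] Disj.prems i by auto
  have a: "encodes (hd (us1 @ [hd (us2 @ [w])])) (holds \<phi> (map X [0..<n])) (hd (us2 @ [w]))"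
    using sat_formula[OF _ i 1, of n] Disj.prems by simp
  obtain v where "local_sat X (False, p) (CHR ''|'') v (hd (us1 @ [hd (us2 @ [w])]))"
    using local_sat_binop_exists[OF a b Disj.prems(2,3), of "\<lambda>a b. a + b - a * b"] unfolding local_sat_binop by blast
  moreover have "sat X (False, p) (enc_formula \<phi> @ enc_formula \<psi>) (us1 @ us2) w"
    using 1 2 by (auto simp: sat_append p')
  moreover have "hd ((us1 @ us2) @ [w]) = hd (us1 @ [hd (us2 @ [w])])" by (cases us1) simp_all
  ultimately have "sat X (False, p) (enc_formula (Disj \<phi> \<psi>)) (v # us1 @ us2) w"
    by simp
  then show ?case by blast
qed

text \<open>On the empty stack 1, pushing the truth value t of the sentence gives (2 t + 1) / 3; the
  demand of \<open>#\<close> that this be 1 means t = 1.\<close>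

lemma sat_sentence:
  assumes "formula_in_vars n \<phi>"
  shows "sat X (False, p) (CHR ''#'' # enc_formula \<phi>) vs (\<lambda>_. 1) \<Longrightarrow>
      holds \<phi> (map X [0..<n]) \<and> hd vs 0 * hd vs 0 = 1"
    and "holds \<phi> (map X [0..<n]) \<Longrightarrow> \<exists>vs. sat X (False, p) (CHR ''#'' # enc_formula \<phi>) vs (\<lambda>_. 1)"
proof -
  assume a: "sat X (False, p) (CHR ''#'' # enc_formula \<phi>) vs (\<lambda>_. 1)"
  then obtain v us where vs: "vs = v # us" by (cases vs) auto
  then show "holds \<phi> (map X [0..<n]) \<and> hd vs 0 * hd vs 0 = 1"
    using a sat_formula[OF assms, of "\<lambda>_. 1" X p us] by (auto simp: local_sat_simps encodes_def of_bool_def split: if_splits)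
next
  assume h: "holds \<phi> (map X [0..<n])"
  obtain us where us: "sat X (False, p) (enc_formula \<phi>) us (\<lambda>_. 1)"
    using sat_formula_exists[OF assms, of "\<lambda>_. 1"] by auto
  then have "sat X (False, p) (CHR ''#'' # enc_formula \<phi>) ((\<lambda>_. 1) # us) (\<lambda>_. 1)"
    using sat_formula[OF assms, of "\<lambda>_. 1" X p us] h by (auto simp: local_sat_simps encodes_def)
  then show "\<exists>vs. sat X (False, p) (CHR ''#'' # enc_formula \<phi>) vs (\<lambda>_. 1)" by blast
qed

section \<open>The polynomial and its values\<close>

datatype role = Plain | Selected | Current | Next

fun refs :: "role \<Rightarrow> nat \<Rightarrow> ref list \<Rightarrow> nat" where
  "refs Plain a rs = 0"
| "refs Selected a rs = (if a = 0 then count_list rs Sel else 0)"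
| "refs Current a rs = count_list rs (Cur a)"
| "refs Next a rs = count_list rs (Nxt a)"

definition cell_exps :: "ref list \<Rightarrow> role \<Rightarrow> nat list" where
  "cell_exps rs r = map (\<lambda>a. refs r a rs) [0..<10]"

text \<open>Behind the last cell there is no \<open>Next\<close>, so the variables of the missing cell read as \<open>1\<close>.  In
  particular the empty stack is \<open>1\<close>.\<close>

definition roles :: "nat \<Rightarrow> nat \<Rightarrow> nat \<Rightarrow> nat \<Rightarrow> role list" where
  "roles n p j k = map (\<lambda>i. if i = p then Selected else Plain) [0..<n] @ replicate j Plain @
     Current # (case k of 0 \<Rightarrow> [] | Suc k' \<Rightarrow> Next # replicate k' Plain)"

definition spell_term :: "role list \<Rightarrow> local_term \<Rightarrow> monomial" where
  "spell_term rls = (\<lambda>(c, rs). (c, concat (map (cell_exps rs) rls)))"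

definition neg_product :: "local_term list \<Rightarrow> local_term list \<Rightarrow> local_term list" where
  "neg_product ts us = concat (map (\<lambda>(a, rs). map (\<lambda>(b, rs'). (- (a * b), rs @ rs')) us) ts)"

text \<open>The minus sign of 1 - (sum of squares) is built into the expanded squares. Only a mode
  and a character enter, so there are finitely many templates and the control can store
  them.\<close>

definition templates :: "bool \<Rightarrow> char \<Rightarrow> local_term list" where
  "templates m c = concat (map (\<lambda>t. neg_product t t) (constraints m c))"

fun penalties :: "nat \<Rightarrow> bool \<times> nat \<Rightarrow> nat \<Rightarrow> string \<Rightarrow> mpolynomial" where
  "penalties n s j [] = []"
| "penalties n s j (c # w) =
     map (spell_term (roles n (snd (advance s c)) j (length w))) (templates (fst s) c) @
     penalties n (advance s c) (Suc j) w"

text \<open>One cell per character of the encoded sentence, its prefix included, so that printing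
  ten blocks per character yields exactly one exponent vector.\<close>

definition num_cells :: "nat \<times> qf_formula \<Rightarrow> nat" where
  "num_cells = (\<lambda>(n, \<phi>). n + Suc (length (enc_formula \<phi>)))"

text \<open>The parser index starts at n, beyond all sentence variables, so that none is
  selected.\<close>

definition etr_poly :: "nat \<times> qf_formula \<Rightarrow> mpolynomial" where
  "etr_poly = (\<lambda>(n, \<phi>). (1, replicate (10 * num_cells (n, \<phi>)) 0) #
     penalties n (False, n) 0 (CHR ''#'' # enc_formula \<phi>))"

definition cells :: "(nat \<Rightarrow> real) list \<Rightarrow> real list" where
  "cells vs = concat (map (\<lambda>v. map v [0..<10]) vs)"

lemma length_cells [simp]: "length (cells vs) = 10 * length vs"
  by (induction vs) (auto simp: cells_def)

lemma cells_append [simp]: "cells (us @ vs) = cells us @ cells vs"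
  by (simp add: cells_def)

lemma cells_Cons: "cells (v # vs) = map v [0..<10] @ cells vs"
  by (simp add: cells_def)

lemma cells_exists: "length x = 10 * k \<Longrightarrow> \<exists>vs. length vs = k \<and> x = cells vs"
proof (induction k arbitrary: x)
  case 0
  then show ?case by (simp add: cells_def)
next
  case (Suc k)
  have "length (drop 10 x) = 10 * k" using Suc.prems by simp
  from Suc.IH[OF this] obtain vs where vs: "length vs = k" "drop 10 x = cells vs" by blast
  have "take 10 x = map ((!) x) [0..<10]"
    using Suc.prems by (intro nth_equalityI) auto
  then have "x = cells ((!) x # vs)"
    unfolding cells_Cons vs(2)[symmetric] by (metis append_take_drop_id)
  then show ?case using vs by (intro exI[of _ "(!) x # vs"]) simp
qed

fun role_val :: "role \<Rightarrow> (nat \<Rightarrow> real) \<Rightarrow> ref \<Rightarrow> real" where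
  "role_val Current v (Cur a) = v a"
| "role_val Next v (Nxt a) = v a"
| "role_val Selected v Sel = v 0"
| "role_val _ v r = 1"

fun small_ref :: "ref \<Rightarrow> bool" where
  "small_ref (Cur a) \<longleftrightarrow> a < 10"
| "small_ref (Nxt a) \<longleftrightarrow> a < 10"
| "small_ref Sel \<longleftrightarrow> True"

definition small_terms :: "local_term list \<Rightarrow> bool" where
  "small_terms ts \<longleftrightarrow> (\<forall>(c, rs)\<in>set ts. \<forall>r\<in>set rs. small_ref r)"

lemma small_constraints: "t \<in> set (constraints m c) \<Longrightarrow> small_terms t"
  by (auto simp: constraints_def keep_def atom_constraints_def binop_constraints_def small_terms_def split: if_splits)

lemma small_templates: "small_terms (templates m c)"
  using small_constraints[of _ m c]
  by (fastforce simp: templates_def neg_product_def small_terms_def)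

lemma cell_exps_val:
  "\<forall>r\<in>set rs. small_ref r \<Longrightarrow>
   prod_list (map2 (^) (map v [0..<10]) (cell_exps rs rl)) = prod_list (map (role_val rl v) rs)"
proof (induction rs)
  case Nil
  have "refs rl a [] = 0" for a by (cases rl) auto
  then show ?case by (simp add: cell_exps_def map_replicate_const prod_list_power_zeros del: upt_rec_numeral)
next
  case (Cons r rs)
  have eq: "prod_list (map2 (^) (map v [0..<10]) (cell_exps rs rl)) = (\<Prod>a<10. v a ^ refs rl a rs)" for rs
  proof -
    have "map2 (^) (map v [0..<10]) (cell_exps rs rl) = map (\<lambda>a. v a ^ refs rl a rs) [0..<10]"
      by (rule nth_equalityI) (simp_all add: cell_exps_def del: upt_rec_numeral)
    then show ?thesis
      using prod.distinct_set_conv_list[of "[0..<10]" "\<lambda>a. v a ^ refs rl a rs"]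
      by (simp add: atLeast0LessThan del: upt_rec_numeral)
  qed
  have one: "(\<Prod>a<10. v a ^ (if a = b then 1 else 0)) = v b" if "b < 10" for b :: nat
  proof -
    have "(\<Prod>a<10. v a ^ (if a = b then 1 else 0)) = (\<Prod>a<10. if a = b then v a else 1)"
      by (rule prod.cong) auto
    then show ?thesis using that by simp
  qed
  have "(\<Prod>a<10. v a ^ refs rl a (r # rs)) = role_val rl v r * (\<Prod>a<10. v a ^ refs rl a rs)"
  proof -
    obtain b where b: "b < 10" "role_val rl v r = 1 \<and> (\<forall>a. refs rl a (r # rs) = refs rl a rs) \<or>
       role_val rl v r = v b \<and> (\<forall>a. refs rl a (r # rs) = (if a = b then 1 else 0) + refs rl a rs)"
      using Cons.prems by (cases rl; cases r) fastforce+
    then show ?thesis by (auto simp: power_add prod.distrib one)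
  qed
  then show ?case using Cons eq by simp
qed

lemma prod_list_mult: "prod_list (map (\<lambda>r. f r * g r) rs) = prod_list (map f rs) * prod_list (map g rs)"
  for f g :: "_ \<Rightarrow> real"
  by (induction rs) auto

lemma roles_val:
  assumes "\<forall>r\<in>set rs. small_ref r" "length rls = length vs"
  shows "prod_list (map2 (^) (cells vs) (concat (map (cell_exps rs) rls))) =
    prod_list (map (\<lambda>r. prod_list (map2 (\<lambda>rl v. role_val rl v r) rls vs)) rs)"
  using assms(2)
proof (induction rls vs rule: list_induct2)
  case Nil
  show ?case by (induction rs) (simp_all add: cells_def)
next
  case (Cons rl rls v vs)
  have "length (map v [0..<10]) = length (cell_exps rs rl)" by (simp add: cell_exps_def)
  then show ?case
    using Cons cell_exps_val[OF assms(1), of v rl] by (simp add: cells_Cons prod_list_mult del: upt_rec_numeral)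
qed

lemma role_val_prefix:
  "prod_list (map2 (\<lambda>rl v. role_val rl v r) (map (\<lambda>i. if i = p then Selected else Plain) [0..<length pre]) pre) =
     (if r = Sel \<and> p < length pre then (pre ! p) 0 else 1)"
proof (induction pre rule: rev_induct)
  case (snoc v pre)
  then show ?case by (cases r) (auto simp: nth_append less_Suc_eq)
qed simp

lemma role_val_Plain: "prod_list (map2 (\<lambda>rl v. role_val rl v r) (replicate k Plain) vs) = 1"
  by (induction vs arbitrary: k) (case_tac k; cases r; simp)+

text \<open>At most one cell answers to a given reference; all others contribute the factor 1, and
  so does a reference that no cell answers.\<close>

lemma roles_ref_val:
  assumes "length pre = n" "length ds = j" "length us = k"
  shows "prod_list (map2 (\<lambda>rl v. role_val rl v r) (roles n p j k) (pre @ ds @ v # us)) =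
    ref_val (if p < n then (pre ! p) 0 else 1) v (hd (us @ [\<lambda>_. 1])) r"
proof -
  have "prod_list (map2 (\<lambda>rl v. role_val rl v r) (case k of 0 \<Rightarrow> [] | Suc k' \<Rightarrow> Next # replicate k' Plain) us) =
     (case r of Nxt a \<Rightarrow> hd (us @ [\<lambda>_. 1]) a | _ \<Rightarrow> 1)"
    using assms(3) by (cases us) (auto simp: role_val_Plain split: ref.split)
  then show ?thesis
    using assms role_val_prefix[of r p pre] by (cases r) (auto simp: roles_def role_val_Plain)
qed

lemma length_roles [simp]: "length (roles n p j k) = n + j + Suc k"
  by (auto simp: roles_def split: nat.split)

lemma length_cell_exps [simp]: "length (concat (map (cell_exps rs) rls)) = 10 * length rls"
  by (induction rls) (auto simp: cell_exps_def)

lemma eval_spell_terms: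
  assumes "small_terms ts" "length pre = n" "length ds = j" "length us = k"
  shows "eval (map (spell_term (roles n p j k)) ts) (cells (pre @ ds @ v # us)) =
    term_val (if p < n then (pre ! p) 0 else 1) v (hd (us @ [\<lambda>_. 1])) ts"
  using assms(1)
proof (induction ts)
  case (Cons t ts)
  obtain c rs where t: "t = (c, rs)" by (cases t)
  have s: "\<forall>r\<in>set rs. small_ref r" using Cons.prems by (auto simp: t small_terms_def)
  have "eval_monomial (spell_term (roles n p j k) t) (cells (pre @ ds @ v # us)) =
      of_int c * prod_list (map (ref_val (if p < n then (pre ! p) 0 else 1) v (hd (us @ [\<lambda>_. 1]))) rs)"
    using roles_val[OF s, of "roles n p j k" "pre @ ds @ v # us"] assms
    by (simp add: t spell_term_def eval_monomial_eq roles_ref_val del: eval_monomial.simps cells_append)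
  then show ?case using Cons by (simp add: small_terms_def term_val_def t del: cells_append)
qed (simp add: term_val_def)

lemma term_val_append: "term_val x v w (ts @ us) = term_val x v w ts + term_val x v w us"
  by (simp add: term_val_def)

lemma term_val_neg_product:
  "term_val x v w (neg_product ts us) = - (term_val x v w ts * term_val x v w us)"
proof (induction ts)
  case (Cons t ts)
  obtain a rs where t: "t = (a, rs)" by (cases t)
  have "term_val x v w (map (\<lambda>(b, rs'). (- (a * b), rs @ rs')) us) =
      - (of_int a * prod_list (map (ref_val x v w) rs) * term_val x v w us)"
    by (induction us) (auto simp: term_val_def algebra_simps)
  then show ?case using Cons
    by (simp add: t neg_product_def term_val_append) (simp add: term_val_def algebra_simps)
qed (simp add: neg_product_def term_val_def)

lemma term_val_templates:
  "term_val x v w (templates m c) = - (\<Sum>t\<leftarrow>constraints m c. (term_val x v w t)\<^sup>2)"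
proof -
  have "term_val x v w (concat (map (\<lambda>t. neg_product t t) ts)) = - (\<Sum>t\<leftarrow>ts. (term_val x v w t)\<^sup>2)" for ts
    by (induction ts)
      (simp_all add: term_val_append term_val_neg_product power2_eq_square, simp add: term_val_def)
  then show ?thesis by (simp add: templates_def)
qed

text \<open>A sum of negative squares vanishes only if every square does. \<open>ds\<close> collects
  the cells already passed.\<close>

lemma eval_penalties:
  assumes "length pre = n" "\<And>i. X i = (if i < n then (pre ! i) 0 else 1)"
  shows "length ds = j \<Longrightarrow> length vs = length w \<Longrightarrow>
    eval (penalties n s j w) (cells (pre @ ds @ vs)) \<le> 0 \<and>
    (eval (penalties n s j w) (cells (pre @ ds @ vs)) = 0 \<longleftrightarrow> sat X s w vs (\<lambda>_. 1))"
proof (induction w arbitrary: s j ds vs)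
  case (Cons c w)
  then obtain v us where vs: "vs = v # us" "length us = length w" by (cases vs) auto
  have IH: "eval (penalties n (advance s c) (Suc j) w) (cells (pre @ ds @ v # us)) \<le> 0 \<and>
    (eval (penalties n (advance s c) (Suc j) w) (cells (pre @ ds @ v # us)) = 0 \<longleftrightarrow> sat X (advance s c) w us (\<lambda>_. 1))"
    using Cons.IH[of "ds @ [v]" "Suc j" us "advance s c"] Cons.prems(1) vs(2) by (simp del: cells_append)
  define q where "q = (\<Sum>t\<leftarrow>constraints (fst s) c. (term_val (X (snd (advance s c))) v (hd (us @ [\<lambda>_. 1])) t)\<^sup>2)"
  have e: "eval (map (spell_term (roles n (snd (advance s c)) j (length w))) (templates (fst s) c)) (cells (pre @ ds @ v # us)) = - q"
    using eval_spell_terms[OF small_templates assms(1) Cons.prems(1) vs(2)]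
    by (simp add: q_def term_val_templates assms(2) del: cells_append)
  have q0: "q \<ge> 0" unfolding q_def by (rule sum_list_nonneg) auto
  have "q = 0 \<longleftrightarrow> local_sat X s c v (hd (us @ [\<lambda>_. 1]))"
    unfolding q_def local_sat_def by (subst sum_list_nonneg_eq_0_iff) auto
  then show ?case using IH e q0 unfolding vs(1) by (auto simp: eval_append simp del: cells_append)
qed simp

lemma etr_poly_in_vars: "in_vars (10 * num_cells (n, \<phi>)) (etr_poly (n, \<phi>))"
proof -
  have "in_vars (10 * (n + (j + length w))) (penalties n s j w)" for j w s
  proof (induction w arbitrary: j s)
    case (Cons c w)
    have "in_vars (10 * (n + (j + length (c # w)))) (penalties n (advance s c) (Suc j) w)"
      using Cons.IH[of "Suc j" "advance s c"] by simp
    then show ?case by (auto simp: in_vars_def spell_term_def)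
  qed (simp add: in_vars_def)
  from this[of 0 "CHR ''#'' # enc_formula \<phi>" "(False, n)"]
  show ?thesis by (auto simp: etr_poly_def in_vars_def num_cells_def)
qed

lemma length_sat: "sat X s w vs e \<Longrightarrow> length vs = length w"
  by (induction X s w vs e rule: sat.induct) auto

lemma eval_etr_poly:
  assumes "length pre = n" "length vs = Suc (length (enc_formula \<phi>))"
  defines "X \<equiv> \<lambda>i. if i < n then (pre ! i) 0 else 1"
  shows "eval (etr_poly (n, \<phi>)) (cells (pre @ vs)) \<le> 1"
    and "eval (etr_poly (n, \<phi>)) (cells (pre @ vs)) = 1 \<longleftrightarrow>
      sat X (False, n) (CHR ''#'' # enc_formula \<phi>) vs (\<lambda>_. 1)"
proof -
  have "eval_monomial (1, replicate (10 * num_cells (n, \<phi>)) 0) (cells (pre @ vs)) = 1"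
    using assms by (simp add: eval_monomial_eq num_cells_def prod_list_power_zeros del: eval_monomial.simps cells_append)
  then have "eval (etr_poly (n, \<phi>)) (cells (pre @ vs)) =
      1 + eval (penalties n (False, n) 0 (CHR ''#'' # enc_formula \<phi>)) (cells (pre @ [] @ vs))"
    by (simp add: etr_poly_def del: cells_append penalties.simps eval_monomial.simps)
  then show "eval (etr_poly (n, \<phi>)) (cells (pre @ vs)) \<le> 1"
    and "eval (etr_poly (n, \<phi>)) (cells (pre @ vs)) = 1 \<longleftrightarrow>
      sat X (False, n) (CHR ''#'' # enc_formula \<phi>) vs (\<lambda>_. 1)"
    using eval_penalties[OF assms(1), of X "[]" 0 vs "CHR ''#'' # enc_formula \<phi>" "(False, n)"] assms(2)
    by (simp_all add: X_def del: cells_append penalties.simps sat.simps)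
qed

lemma midpoint_append:
  "length a = length b \<Longrightarrow> midpoint_list (a @ c) (b @ d) = midpoint_list a b @ midpoint_list c d"
  by (simp add: midpoint_list_def)

lemma midpoint_same: "midpoint_list a a = a"
  by (induction a) (auto simp: midpoint_list_def)

lemma etr_poly_correct:
  assumes \<phi>: "formula_in_vars n \<phi>"
  shows "(\<exists>p q. length p = 10 * num_cells (n, \<phi>) \<and> length q = 10 * num_cells (n, \<phi>) \<and>
      eval (etr_poly (n, \<phi>)) p \<ge> 1 \<and> eval (etr_poly (n, \<phi>)) q \<ge> 1 \<and>
      eval (etr_poly (n, \<phi>)) (midpoint_list p q) < 1) \<longleftrightarrow> (\<exists>x. length x = n \<and> holds \<phi> x)"
proof
  assume "\<exists>p q. length p = 10 * num_cells (n, \<phi>) \<and> length q = 10 * num_cells (n, \<phi>) \<and>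
      eval (etr_poly (n, \<phi>)) p \<ge> 1 \<and> eval (etr_poly (n, \<phi>)) q \<ge> 1 \<and>
      eval (etr_poly (n, \<phi>)) (midpoint_list p q) < 1"
  \<comment> \<open>Either one of the two points solves all constraints, since the polynomial never
    exceeds 1.\<close>
  then obtain us where us: "length us = num_cells (n, \<phi>)" and e: "eval (etr_poly (n, \<phi>)) (cells us) \<ge> 1"
    using cells_exists by blast
  define pre vs where "pre = take n us" and "vs = drop n us"
  have l: "length pre = n" "length vs = Suc (length (enc_formula \<phi>))" "us = pre @ vs"
    using us by (auto simp: pre_def vs_def num_cells_def)
  have "eval (etr_poly (n, \<phi>)) (cells (pre @ vs)) = 1" using e eval_etr_poly(1)[OF l(1,2)] l(3) by simp
  then have "holds \<phi> (map (\<lambda>i. if i < n then (pre ! i) 0 else 1) [0..<n])"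
    using eval_etr_poly(2)[OF l(1,2)] sat_sentence(1)[OF \<phi>] by blast
  then show "\<exists>x. length x = n \<and> holds \<phi> x" by (metis length_map length_upt minus_nat.diff_0)
next
  assume "\<exists>x. length x = n \<and> holds \<phi> x"
  then obtain x where x: "length x = n" "holds \<phi> x" by blast
  define pre where "pre = map (\<lambda>i (_ :: nat). x ! i) [0..<n]"
  define X where "X = (\<lambda>i. if i < n then (pre ! i) 0 else 1)"
  have X: "map X [0..<n] = x" using x(1) by (intro nth_equalityI) (auto simp: X_def pre_def)
  have pre: "length pre = n" by (simp add: pre_def)
  obtain vs where "sat X (False, n) (CHR ''#'' # enc_formula \<phi>) vs (\<lambda>_. 1)"
    using sat_sentence(2)[OF \<phi>, of X n] X x(2) by auto
  then obtain v us where s: "sat X (False, n) (CHR ''#'' # enc_formula \<phi>) (v # us) (\<lambda>_. 1)"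
    by (cases vs) auto
  have l: "length us = length (enc_formula \<phi>)" using length_sat[OF s] by simp
  \<comment> \<open>Here z is variable 0 of the cell of \<open>#\<close>. No cell to its left
    carries constraints, so z occurs in z^2 = 1 only and can vary without disturbing other
    equations.\<close>
  define P where "P z = cells (pre @ (\<lambda>i. if i = 0 then z else v i) # us)" for z
  have P: "eval (etr_poly (n, \<phi>)) (P z) \<le> 1" "eval (etr_poly (n, \<phi>)) (P z) = 1 \<longleftrightarrow> z * z = 1" for z
    unfolding P_def using eval_etr_poly[OF pre, of "(\<lambda>i. if i = 0 then z else v i) # us" \<phi>] l s
    by (auto simp: X_def[symmetric] local_sat_simps simp del: cells_append)
  have "midpoint_list (P 1) (P (- 1)) = P 0"
  proof -
    have "midpoint_list (map (\<lambda>i. if i = 0 then 1 else v i) [0..<10]) (map (\<lambda>i. if i = 0 then - 1 else v i) [0..<10]) =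
        map (\<lambda>i. if i = 0 then 0 else v i) [0..<10]"
      by (auto simp: midpoint_list_def intro!: nth_equalityI)
    then show ?thesis by (simp add: P_def cells_Cons midpoint_append midpoint_same del: upt_rec_numeral)
  qed
  then show "\<exists>p q. length p = 10 * num_cells (n, \<phi>) \<and> length q = 10 * num_cells (n, \<phi>) \<and>
      eval (etr_poly (n, \<phi>)) p \<ge> 1 \<and> eval (etr_poly (n, \<phi>)) q \<ge> 1 \<and>
      eval (etr_poly (n, \<phi>)) (midpoint_list p q) < 1"
    using P[of 1] P[of "- 1"] P[of 0] pre l
    by (intro exI[of _ "P 1"] exI[of _ "P (- 1)"]) (auto simp: P_def num_cells_def simp del: cells_append)
qed

section \<open>A sweep machine that prints the polynomial\<close>

datatype job = Size | One | Load bool "char option" | Shift bool bool | Print bool "local_term list"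

text \<open>The processed cells of the formula carry \<open>D\<close>, so that the first other cell behind the
  prefix is the current one; the cell of the current variable carries \<open>X\<close>.\<close>

definition locate :: "nat \<Rightarrow> char \<Rightarrow> role \<times> nat" where
  "locate ph c =
     (if ph = 0 \<and> c = CHR ''x'' then (Plain, 0) else if ph = 0 \<and> c = CHR ''X'' then (Selected, 0)
      else if ph \<le> 1 then (if c = CHR ''D'' then (Plain, 1) else (Current, 2))
      else if ph = 2 then (Next, 3) else (Plain, 3))"

fun job_out :: "job \<Rightarrow> role \<Rightarrow> string" where
  "job_out Size rl = replicate 10 (CHR ''x'')"
| "job_out One rl = replicate 10 (CHR ''x'')"
| "job_out (Print m ((c, rs) # ts)) rl = blocks (cell_exps rs rl)"
| "job_out k rl = []"

text \<open>\<open>ph\<close> is 0 in the prefix, 1 among processed cells, 2 right behind the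
  current cell, 3 further on. \<open>Load\<close> marks the current cell as processed and picks up
  the character behind it; \<open>Shift\<close> moves the \<open>X\<close>, its flag telling whether
  the next prefix cell receives it.\<close>

fun etr_delta :: "job \<times> nat \<Rightarrow> char \<Rightarrow> (job \<times> nat) \<times> char \<times> string" where
  "etr_delta (k, ph) c = (case locate ph c of (rl, ph') \<Rightarrow>
     ((case k of Load m r \<Rightarrow> Load m (if rl = Next then Some c else r)
       | Shift m b \<Rightarrow> Shift m (if ph' = 0 then m \<and> c = CHR ''X'' else b)
       | _ \<Rightarrow> k, ph'),
      case k of Load m r \<Rightarrow> (if rl = Current then CHR ''D'' else c)
       | Shift m b \<Rightarrow> (if ph' = 0 then (if b then CHR ''X'' else CHR ''x'') else c)
       | _ \<Rightarrow> c,
      job_out k rl))"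

text \<open>A coefficient is printed between two sweeps, its exponents during the next one. An
  exhausted list means that the cell is finished and its successor gets loaded.\<close>

fun launch :: "bool \<Rightarrow> local_term list \<Rightarrow> string \<times> (job \<times> nat)" where
  "launch m [] = ([], (Load m None, 0))"
| "launch m ((c, rs) # ts) = (enc_int c, (Print m ((c, rs) # ts), 0))"

text \<open>Only \<open>x\<close> changes the current variable and thus costs a \<open>Shift\<close>
  sweep; the flag starts as True for the first block of a monomial, which selects variable
  0.\<close>

fun etr_fin :: "job \<times> nat \<Rightarrow> string \<times> (job \<times> nat) option" where
  "etr_fin (Size, ph) = (''#1'', Some (One, 0))"
| "etr_fin (One, ph) = ('';'' @ fst (launch False (templates False (CHR ''#''))),
     Some (snd (launch False (templates False (CHR ''#'')))))"
| "etr_fin (Load m None, ph) = (''#1/1'', None)"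
| "etr_fin (Load m (Some c), ph) =
     (if c = CHR ''x'' then ([], Some (Shift m (\<not> m), 0))
      else (fst (launch (m \<and> c = CHR ''1'') (templates m c)), Some (snd (launch (m \<and> c = CHR ''1'') (templates m c)))))"
| "etr_fin (Shift m b, ph) =
     (fst (launch True (templates m (CHR ''x''))), Some (snd (launch True (templates m (CHR ''x'')))))"
| "etr_fin (Print m ts, ph) = ('';'' @ fst (launch m (tl ts)), Some (snd (launch m (tl ts))))"

text \<open>The state type is infinite, but what \<open>Print\<close> carries is always a suffix of
  one of finitely many templates.\<close>

definition etr_states :: "(job \<times> nat) set" where
  "etr_states = {(k, ph). ph \<le> 3 \<and> (\<forall>m ts. k = Print m ts \<longrightarrow> (\<exists>m' c. suffix ts (templates m' c)))}"

lemma finite_etr_states: "finite etr_states"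
proof -
  define P where "P = (\<Union>m. \<Union>c. set (suffixes (templates m c)))"
  define J where "J = {Size, One} \<union> case_prod Load ` UNIV \<union> case_prod Shift ` UNIV \<union> case_prod Print ` (UNIV \<times> P)"
  have "finite P" unfolding P_def by (intro finite_UN_I finite_class.finite_UNIV finite_set)
  then have "finite (J \<times> {..3 :: nat})"
    unfolding J_def by simp
  moreover have "etr_states \<subseteq> J \<times> {..3}"
  proof
    fix q assume "q \<in> etr_states"
    then obtain k ph where q: "q = (k, ph)" "ph \<le> 3" "\<And>m ts. k = Print m ts \<Longrightarrow> ts \<in> P"
      by (auto simp: etr_states_def P_def)
    then have "k \<in> J" by (cases k) (simp_all add: J_def image_iff split_paired_Ex)
    then show "q \<in> J \<times> {..3}" using q by simp
  qed
  ultimately show ?thesis by (rule finite_subset[rotated])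
qed

lemma launch_states: "suffix ts (templates m c) \<Longrightarrow> snd (launch m' ts) \<in> etr_states"
proof (cases ts)
  case (Cons t us)
  assume "suffix ts (templates m c)"
  then show ?thesis using Cons by (cases t) (simp add: etr_states_def, blast)
qed (simp add: etr_states_def)

lemma etr_machine: "sweep_machine etr_delta etr_fin etr_states (Size, 0)"
proof
  show "finite etr_states" by (rule finite_etr_states)
  show "(Size, 0) \<in> etr_states" by (auto simp: etr_states_def)
  show "fst (etr_delta q c) \<in> etr_states" if "q \<in> etr_states" for q c
  proof -
    obtain k ph where q: "q = (k, ph)" by (cases q)
    have "snd (locate ph c) \<le> 3" by (auto simp: locate_def)
    then show ?thesis using that
      by (cases k) (auto simp: q etr_states_def split: prod.split)
  qed
  show "q' \<in> etr_states" if q: "q \<in> etr_states" and f: "etr_fin q = (e, Some q')" for q e q'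
  proof -
    have l: "snd (launch m' (templates m c)) \<in> etr_states" for m' m c
      by (rule launch_states[OF suffix_order.refl])
    have j: "(One, 0) \<in> etr_states" "(Shift m b, 0) \<in> etr_states" for m b
      by (simp_all add: etr_states_def)
    show ?thesis
    proof (cases q rule: etr_fin.cases)
      case (4 m c ph)
      then show ?thesis using f l j by (cases "c = CHR ''x''") auto
    next
      case (6 m ts ph)
      then obtain m' c where "suffix ts (templates m' c)" using q by (auto simp: etr_states_def)
      then have "suffix (tl ts) (templates m' c)" by (cases ts) (auto dest: suffix_ConsD)
      then have "snd (launch m (tl ts)) \<in> etr_states" by (rule launch_states)
      then show ?thesis using 6 f by auto
    qed (use f l j in auto)
  qed
qed

definition prefix_word :: "nat \<Rightarrow> nat \<Rightarrow> string" where
  "prefix_word n p = map (\<lambda>i. if i = p then CHR ''X'' else CHR ''x'') [0..<n]"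

definition etr_tape :: "nat \<Rightarrow> nat \<Rightarrow> nat \<Rightarrow> string \<Rightarrow> string" where
  "etr_tape n p j w = prefix_word n p @ replicate j (CHR ''D'') @ w"

definition follow_roles :: "nat \<Rightarrow> role list" where
  "follow_roles k = (case k of 0 \<Rightarrow> [] | Suc k' \<Rightarrow> Next # replicate k' Plain)"

definition phase_after :: "nat \<Rightarrow> nat \<Rightarrow> nat" where
  "phase_after ph k = (if k = 0 then ph else 3)"

text \<open>What lets a sweep recognize the current cell: behind a \<open>D\<close>, an
  \<open>x\<close> belongs to the sentence, but before any \<open>D\<close> it would be taken for a
  prefix cell.\<close>

definition current_ok :: "nat \<Rightarrow> char \<Rightarrow> bool" where
  "current_ok j c \<longleftrightarrow> c \<noteq> CHR ''D'' \<and> (j = 0 \<longrightarrow> c \<noteq> CHR ''x'' \<and> c \<noteq> CHR ''X'')"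

lemma pass_prefix:
  assumes "\<And>m b. k \<noteq> Shift m b"
  shows "pass etr_delta (k, 0) (map (\<lambda>i. if i = p then CHR ''X'' else CHR ''x'') is) =
     ((k, 0), map (\<lambda>i. if i = p then CHR ''X'' else CHR ''x'') is,
      concat (map (job_out k) (map (\<lambda>i. if i = p then Selected else Plain) is)))"
  using assms by (induction "is") (auto simp: locate_def split: job.split)

lemma pass_done:
  "ph \<le> 1 \<Longrightarrow> pass etr_delta (k, ph) (replicate j (CHR ''D'')) =
     ((k, if j = 0 then ph else 1), replicate j (CHR ''D''), concat (map (job_out k) (replicate j Plain)))"
  by (induction j arbitrary: ph) (auto simp: locate_def split: job.split)

lemma pass_rest:
  "pass etr_delta (k, 3) w = ((k, 3), w, concat (map (job_out k) (replicate (length w) Plain)))"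
  by (induction w) (auto simp: locate_def split: job.split)

lemma pass_follow:
  "pass etr_delta (k, 2) w = ((case k of Load m r \<Rightarrow> Load m (if w = [] then r else Some (hd w)) | _ \<Rightarrow> k,
     phase_after 2 (length w)), w, concat (map (job_out k) (follow_roles (length w))))"
proof (cases w)
  case (Cons c w')
  then show ?thesis
    using pass_rest[of _ w'] by (cases k) (auto simp: locate_def phase_after_def follow_roles_def)
qed (auto simp: phase_after_def follow_roles_def split: job.split)

lemma locate_current:
  "current_ok j c \<Longrightarrow> locate (if j = 0 then 0 else 1) c = (Current, 2)"
  by (auto simp: current_ok_def locate_def)

lemma pass_from_prefix:
  assumes "current_ok j c"
  shows "pass etr_delta (k, 0) (replicate j (CHR ''D'') @ c # w) =
     ((case k of Load m r \<Rightarrow> Load m (if w = [] then r else Some (hd w)) | _ \<Rightarrow> k, phase_after 2 (length w)),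
      replicate j (CHR ''D'') @ (case k of Load m r \<Rightarrow> CHR ''D'' | _ \<Rightarrow> c) # w,
      concat (map (job_out k) (replicate j Plain @ Current # follow_roles (length w))))"
proof -
  have "etr_delta (k, if j = 0 then 0 else 1) c =
     ((k, 2), case k of Load m r \<Rightarrow> CHR ''D'' | _ \<Rightarrow> c, job_out k Current)"
    using locate_current[OF assms] by (cases k) (auto split: if_splits)
  then have "pass etr_delta (k, if j = 0 then 0 else 1) (c # w) =
     ((case k of Load m r \<Rightarrow> Load m (if w = [] then r else Some (hd w)) | _ \<Rightarrow> k, phase_after 2 (length w)),
      (case k of Load m r \<Rightarrow> CHR ''D'' | _ \<Rightarrow> c) # w,
      concat (map (job_out k) (Current # follow_roles (length w))))"
    using pass_follow[of k w] by (simp del: etr_delta.simps)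
  from pass_append_eq[OF pass_done this] show ?thesis by simp
qed

lemma pass_tape:
  assumes "current_ok j c" "\<And>m b. k \<noteq> Shift m b"
  shows "pass etr_delta (k, 0) (etr_tape n p j (c # w)) =
     ((case k of Load m r \<Rightarrow> Load m (if w = [] then r else Some (hd w)) | _ \<Rightarrow> k, phase_after 2 (length w)),
      etr_tape n p j ((case k of Load m r \<Rightarrow> CHR ''D'' | _ \<Rightarrow> c) # w),
      concat (map (job_out k) (roles n p j (length w))))"
  using pass_append_eq[OF pass_prefix[OF assms(2)] pass_from_prefix[OF assms(1)]]
  by (simp add: etr_tape_def prefix_word_def roles_def follow_roles_def)

text \<open>Invariant: on reaching cell k, the flag tells whether k is the new place of
  \<open>X\<close>. A place beyond the prefix leaves no cell marked.\<close>

lemma pass_Shift_prefix: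
  defines "q \<equiv> \<lambda>m p. if m then Suc p else 0 :: nat"
  shows "\<exists>b. pass etr_delta (Shift m (k = q m p), 0) (map (\<lambda>i. if i = p then CHR ''X'' else CHR ''x'') [k..<k + d]) =
     ((Shift m b, 0), map (\<lambda>i. if i = q m p then CHR ''X'' else CHR ''x'') [k..<k + d], [])"
proof (induction d arbitrary: k)
  case (Suc d)
  have "m \<and> k = p \<longleftrightarrow> Suc k = q m p" by (auto simp: q_def)
  then have "etr_delta (Shift m (k = q m p), 0) (if k = p then CHR ''X'' else CHR ''x'') =
      ((Shift m (Suc k = q m p), 0), if k = q m p then CHR ''X'' else CHR ''x'', [])"
    by (auto simp: locate_def)
  then show ?case using Suc.IH[of "Suc k"] by (auto simp: upt_conv_Cons simp del: etr_delta.simps upt_Suc)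
qed simp

lemma pass_Shift:
  assumes "current_ok j c"
  shows "\<exists>b ph. pass etr_delta (Shift m (\<not> m), 0) (etr_tape n p j (c # w)) =
     ((Shift m b, ph), etr_tape n (if m then Suc p else 0) j (c # w), [])"
proof -
  have "(0 = (if m then Suc p else 0)) = (\<not> m)" by simp
  then obtain b where "pass etr_delta (Shift m (\<not> m), 0) (prefix_word n p) =
     ((Shift m b, 0), prefix_word n (if m then Suc p else 0), [])"
    using pass_Shift_prefix[of m 0 p n] by (auto simp: prefix_word_def)
  moreover have "concat (map (job_out (Shift m b)) rls) = []" for rls
    by (induction rls) auto
  ultimately show ?thesis
    using pass_append_eq[OF _ pass_from_prefix[OF assms]] by (fastforce simp: etr_tape_def)
qed

lemma concat_blocks: "concat (map (\<lambda>rl. blocks (cell_exps rs rl)) rls) = blocks (concat (map (cell_exps rs) rls))"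
  by (induction rls) auto

text \<open>The first coefficient is printed before these sweeps start, so it is joined to their
  output \<open>u\<close>.\<close>

lemma sweeps_print:
  assumes "current_ok j c" "sweeps etr_delta etr_fin M (Load m None, 0) (etr_tape n p j (c # w)) v"
  shows "\<exists>u. sweeps etr_delta etr_fin (M + length ts) (snd (launch m ts)) (etr_tape n p j (c # w)) u \<and>
    fst (launch m ts) @ u = enc_poly (map (spell_term (roles n p j (length w))) ts) @ v"
proof (induction ts)
  case Nil
  then show ?case using assms(2) by auto
next
  case (Cons t ts)
  obtain a rs where t: "t = (a, rs)" by (cases t)
  obtain u where u: "sweeps etr_delta etr_fin (M + length ts) (snd (launch m ts)) (etr_tape n p j (c # w)) u"
    "fst (launch m ts) @ u = enc_poly (map (spell_term (roles n p j (length w))) ts) @ v"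
    using Cons.IH by blast
  have "pass etr_delta (Print m (t # ts), 0) (etr_tape n p j (c # w)) =
      ((Print m (t # ts), phase_after 2 (length w)), etr_tape n p j (c # w),
       blocks (concat (map (cell_exps rs) (roles n p j (length w)))))"
  proof -
    have "job_out (Print m (t # ts)) = (\<lambda>rl. blocks (cell_exps rs rl))" by (rule ext) (simp add: t)
    then show ?thesis
      using pass_tape[OF assms(1), of "Print m (t # ts)" n p w] by (simp add: concat_blocks)
  qed
  moreover have "etr_fin (Print m (t # ts), ph) = ('';'' @ fst (launch m ts), Some (snd (launch m ts)))" for ph
    by simp
  ultimately have "sweeps etr_delta etr_fin (Suc (M + length ts)) (Print m (t # ts), 0) (etr_tape n p j (c # w))
      (blocks (concat (map (cell_exps rs) (roles n p j (length w)))) @ ('';'' @ fst (launch m ts)) @ u)"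
    using sweeps_againI[OF _ _ u(1) refl] by blast
  with u(2) show ?case by (auto simp: t spell_term_def)
qed

text \<open>Each character costs one \<open>Load\<close>, at most one \<open>Shift\<close> and one
  sweep for each of at most T template monomials; a final \<open>Load\<close> finds no next
  cell.\<close>

lemma sweeps_Load:
  assumes T: "\<And>m c. length (templates m c) \<le> T"
  shows "current_ok j c \<Longrightarrow> CHR ''D'' \<notin> set w \<Longrightarrow> \<exists>M \<le> (T + 2) * length w + 1.
    sweeps etr_delta etr_fin M (Load m None, 0) (etr_tape n p j (c # w))
      (enc_poly (penalties n (m, p) (Suc j) w) @ ''#1/1'')"
proof (induction w arbitrary: j c m p)
  case Nil
  have "pass etr_delta (Load m None, 0) (etr_tape n p j [c]) =
     ((Load m None, phase_after 2 0), etr_tape n p j ''D'', concat (map (job_out (Load m None)) (roles n p j 0)))"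
    using pass_tape[OF Nil.prems(1), of "Load m None" n p "[]"] by simp
  moreover have "concat (map (job_out (Load m None)) rls) = []" for rls by (induction rls) auto
  ultimately have "pass etr_delta (Load m None, 0) (etr_tape n p j [c]) =
     ((Load m None, phase_after 2 0), etr_tape n p j ''D'', [])" by simp
  from sweeps.stop[OF this, of etr_fin "''#1/1''"] show ?case by (intro exI[of _ 1]) simp
next
  case (Cons d w)
  define m' p' where "m' = fst (advance (m, p) d)" and "p' = snd (advance (m, p) d)"
  have ok: "current_ok (Suc j) d" using Cons.prems by (auto simp: current_ok_def)
  obtain M where M: "M \<le> (T + 2) * length w + 1"
    "sweeps etr_delta etr_fin M (Load m' None, 0) (etr_tape n p' (Suc j) (d # w))
      (enc_poly (penalties n (m', p') (Suc (Suc j)) w) @ ''#1/1'')"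
    using Cons.IH[OF ok, of m' p'] Cons.prems by auto
  obtain u where u: "sweeps etr_delta etr_fin (M + length (templates m d)) (snd (launch m' (templates m d)))
      (etr_tape n p' (Suc j) (d # w)) u"
    "fst (launch m' (templates m d)) @ u = enc_poly (penalties n (m, p) (Suc j) (d # w)) @ ''#1/1''"
    using sweeps_print[OF ok M(2), of "templates m d"] by (auto simp: m'_def p'_def simp del: advance.simps)
  have "concat (map (job_out (Load m None)) rls) = []" for rls by (induction rls) auto
  moreover have "etr_tape n p j (CHR ''D'' # d # w) = etr_tape n p (Suc j) (d # w)"
    by (simp add: etr_tape_def replicate_app_Cons_same)
  ultimately have l: "pass etr_delta (Load m None, 0) (etr_tape n p j (c # d # w)) =
     ((Load m (Some d), phase_after 2 (length (d # w))), etr_tape n p (Suc j) (d # w), [])"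
    using pass_tape[OF Cons.prems(1), of "Load m None" n p "d # w"] by simp
  show ?case
  proof (cases "d = CHR ''x''")
    case True
    obtain b ph where "pass etr_delta (Shift m (\<not> m), 0) (etr_tape n p (Suc j) (d # w)) =
       ((Shift m b, ph), etr_tape n p' (Suc j) (d # w), [])"
      using pass_Shift[OF ok, of m n p w] by (auto simp: p'_def True)
    moreover have "etr_fin (Shift m b, ph) = (fst (launch m' (templates m d)), Some (snd (launch m' (templates m d))))"
      by (simp add: m'_def True)
    ultimately have "sweeps etr_delta etr_fin (Suc (M + length (templates m d))) (Shift m (\<not> m), 0)
        (etr_tape n p (Suc j) (d # w)) (enc_poly (penalties n (m, p) (Suc j) (d # w)) @ ''#1/1'')"
      using sweeps_againI[OF _ _ u(1)] u(2) by (metis append_Nil)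
    moreover have "etr_fin (Load m (Some d), ph') = ([], Some (Shift m (\<not> m), 0))" for ph'
      by (simp add: True)
    ultimately have "sweeps etr_delta etr_fin (Suc (Suc (M + length (templates m d)))) (Load m None, 0)
        (etr_tape n p j (c # d # w)) (enc_poly (penalties n (m, p) (Suc j) (d # w)) @ ''#1/1'')"
      using sweeps_againI[OF l] by (metis append_Nil)
    moreover have "Suc (Suc (M + length (templates m d))) \<le> (T + 2) * length (d # w) + 1"
      using M(1) T[of m d] by simp
    ultimately show ?thesis by blast
  next
    case False
    then have "p' = p" "etr_fin (Load m (Some d), ph) = (fst (launch m' (templates m d)), Some (snd (launch m' (templates m d))))" for ph
      by (simp_all add: p'_def m'_def)
    then have "sweeps etr_delta etr_fin (Suc (M + length (templates m d))) (Load m None, 0)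
        (etr_tape n p j (c # d # w)) (enc_poly (penalties n (m, p) (Suc j) (d # w)) @ ''#1/1'')"
      using sweeps_againI[OF l _ _ ] u by (metis append_Nil)
    moreover have "Suc (M + length (templates m d)) \<le> (T + 2) * length (d # w) + 1"
      using M(1) T[of m d] by simp
    ultimately show ?thesis by blast
  qed
qed

lemma D_notin_enc_formula: "CHR ''D'' \<notin> set (enc_formula \<phi>)"
  using set_enc_poly by (induction \<phi>) fastforce+

lemma sweeps_etr:
  assumes T: "\<And>m c. length (templates m c) \<le> T"
  shows "\<exists>M \<le> (T + 3) * Suc (length (encode ETR (n, \<phi>))).
    sweeps etr_delta etr_fin M (Size, 0) (encode ETR (n, \<phi>))
      (encode VSC (10 * num_cells (n, \<phi>), etr_poly (n, \<phi>), 1))"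
proof -
  let ?w = "enc_formula \<phi>" and ?ts = "templates False (CHR ''#'')"
  let ?t = "etr_tape n n 0 (CHR ''#'' # ?w)"
  have "prefix_word n n = replicate n (CHR ''x'')"
    by (rule nth_equalityI) (simp_all add: prefix_word_def)
  then have t: "encode ETR (n, \<phi>) = ?t" by (simp add: ETR_def enc_dim_def etr_tape_def)
  have ok: "current_ok 0 (CHR ''#'')" by (simp add: current_ok_def)
  obtain M where M: "M \<le> (T + 2) * length ?w + 1"
    "sweeps etr_delta etr_fin M (Load False None, 0) ?t (enc_poly (penalties n (False, n) 1 ?w) @ ''#1/1'')"
    using sweeps_Load[OF T ok D_notin_enc_formula[of \<phi>], where m = False and n = n and p = n] by auto
  obtain u where u: "sweeps etr_delta etr_fin (M + length ?ts) (snd (launch False ?ts)) ?t u"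
    "fst (launch False ?ts) @ u = enc_poly (penalties n (False, n) 0 (CHR ''#'' # ?w)) @ ''#1/1''"
    using sweeps_print[OF ok M(2), of ?ts] by auto
  have c: "concat (map (job_out k) rls) = replicate (10 * length rls) (CHR ''x'')" if "k \<in> {Size, One}" for k rls
    using that by (induction rls) (auto simp: replicate_add)
  have one: "pass etr_delta (One, 0) ?t =
      ((One, phase_after 2 (length ?w)), ?t, replicate (10 * num_cells (n, \<phi>)) (CHR ''x''))"
    using pass_tape[OF ok, of One n n ?w] by (simp add: c num_cells_def)
  have size: "pass etr_delta (Size, 0) ?t =
      ((Size, phase_after 2 (length ?w)), ?t, replicate (10 * num_cells (n, \<phi>)) (CHR ''x''))"
    using pass_tape[OF ok, of Size n n ?w] by (simp add: c num_cells_def)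
  have "sweeps etr_delta etr_fin (Suc (Suc (M + length ?ts))) (Size, 0) ?t
      (encode VSC (10 * num_cells (n, \<phi>), etr_poly (n, \<phi>), 1))"
    by (rule sweeps_againI[OF size etr_fin.simps(1) sweeps_againI[OF one etr_fin.simps(2) u(1) refl]])
      (use u(2) in \<open>simp add: VSC_def enc_dim_def etr_poly_def enc_rat_def del: penalties.simps\<close>)
  moreover have "Suc (Suc (M + length ?ts)) \<le> (T + 3) * Suc (length (encode ETR (n, \<phi>)))"
  proof -
    have "length ?w + 2 \<le> Suc (length (encode ETR (n, \<phi>)))" by (simp add: ETR_def enc_dim_def)
    then have "(T + 3) * (length ?w + 2) \<le> (T + 3) * Suc (length (encode ETR (n, \<phi>)))" by (rule mult_le_mono2)
    moreover have "Suc (Suc (M + length ?ts)) \<le> (T + 3) * (length ?w + 2)"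
      using M(1) T[of False "CHR ''#''"] by (simp add: algebra_simps)
    ultimately show ?thesis by linarith
  qed
  ultimately show ?thesis unfolding t by blast
qed

theorem VSC_ER_hard: "ER_hard VSC"
proof -
  define g where "g = (\<lambda>x. (10 * num_cells x, etr_poly x, 1 :: rat))"
  obtain T where T: "\<And>m c. length (templates m c) \<le> T"
  proof -
    have "length (templates m c) \<le> Max (range (\<lambda>(m, c). length (templates m c)))" for m c
      by (rule Max_ge) auto
    then show thesis using that by blast
  qed
  have "poly_time_computable ETR VSC g"
  proof (rule sweep_machine.poly_time[OF etr_machine])
    fix x assume "x \<in> instances ETR"
    obtain n \<phi> where x: "x = (n, \<phi>)" by (cases x)
    show "\<exists>M\<le>poly [:T + 3, T + 3:] (length (encode ETR x)).
        sweeps etr_delta etr_fin M (Size, 0) (encode ETR x) (encode VSC (g x))"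
      using sweeps_etr[OF T, of n \<phi>] by (simp add: x g_def algebra_simps)
  qed
  moreover have "g x \<in> instances VSC \<and> (question ETR x \<longleftrightarrow> question VSC (g x))" if "x \<in> instances ETR" for x
  proof -
    obtain n \<phi> where x: "x = (n, \<phi>)" by (cases x)
    have \<phi>: "formula_in_vars n \<phi>" using that by (simp add: x ETR_def)
    show ?thesis
      using etr_poly_in_vars[of n \<phi>] etr_poly_correct[OF \<phi>] by (simp add: x g_def ETR_def VSC_def)
  qed
  ultimately show ?thesis
    unfolding ER_hard_def poly_time_reducible_def using wf_problem_VSC by blast
qed

theorem theorem4p2:
  shows "ER_hard VSC \<and> ER_complete VSC"
  using VSC_ER_hard VSC_in_ER by (simp add: ER_complete_def)

end
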